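(* Let $G$ be a tree with $n$ sites and maximum vertex-degree $\Delta\in\{3,4,\dots,10\}$, let $h=h(\Delta)$ and $f(\Delta)$ be given by $$\begin{array}{c|cccccccc}\Delta&3&4&5&6&7&8&9&10\\ \hline h&15&3&12&3&7&13&85&5\\ f(\Delta)&5&7&8&10&11&12&13&15\end{array}$$ and let $\mathcal{M}_{\mathrm{tree}}$ be the systematic scan Markov chain on proper $q$-colourings of $G$ with transition matrix $\prod_{k=1}^m P^{[k]}$, where $P^{[k]}$ performs a heat-bath move on the block $\Theta_k$ and the blocks $\Theta_1,\dots,\Theta_m$ are subtree blocks of height $h$ covering the tree. If $q\ge f(\Delta)$ then $$\mathrm{Mix}(\mathcal{M}_{\mathrm{tree}},\varepsilon)=O(\log(n\varepsilon^{-1})),$$ for fixed $\Delta$ and $q$.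
   Context: $G=(V,E)$ is a rooted tree with $V=\{1,\dots,n\}$; $C=\{1,\dots,q\}$ is the set of colours. The state space is the set $\Omega$ of proper $q$-colourings of $G$ and $\pi$ is the uniform distribution on $\Omega$. Blocks: each block $\Theta_k$ consists of a site $r$ together with all sites below $r$ in the tree that are at most $h-1$ edges away from $r$; $h$ is called the height of the blocks. The set of blocks covers all sites of the tree and is constructed so that no block has height less than $h$; the order of the blocks is arbitrary but fixed. Heat-bath move on $\Theta_k$ from $x$: draw a new configuration uniformly at random from the set of configurations that agree with $x$ on $V\setminus\Theta_k$ and in which no edge incident to a site of $\Theta_k$ is monochromatic. Mixing time: for a chain $\mathcal{M}$ with transition matrix $P$ and stationary distribution $\pi$, $\mathrm{Mix}_x(\mathcal{M},\varepsilon)=\min\{t>0:\mathrm{d}_{\mathrm{TV}}(P^t(x,\cdot),\pi(\cdot))\le\varepsilon\}$ and $\mathrm{Mix}(\mathcal{M},\varepsilon)=\max_x\mathrm{Mix}_x(\mathcal{M},\varepsilon)$, the maximum being over all initial configurations, where $\mathrm{d}_{\mathrm{TV}}(\theta_1,\theta_2)=\frac12\sum_i|\theta_1(i)-\theta_2(i)|$. One step of the chain is one full scan. *)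

theory Defs
  imports "HOL-Probability.Probability" "Graph_Theory.Graph_Theory"
begin

section \<open>Rooted trees\<close>

text \<open>
  A simple undirected graph is a symmetric loop-free digraph (\<open>pair_graph\<close>), so every edge is a
  pair of opposite arcs. The constant \<open>Digraph_Component.tree\<close> is not the notion needed here: it
  forbids all directed cycles, including \<open>u \<rightarrow> v \<rightarrow> u\<close>, and hence fails on every symmetric digraph
  that has an edge. The cycles of the undirected graph are the cycles of length at least 3.
\<close>

definition undirected_tree :: "'a pair_pre_digraph \<Rightarrow> bool" where
  "undirected_tree G \<longleftrightarrow> pair_graph G \<and> Digraph_Component.connected (with_proj G) \<and>
     \<not> (\<exists>p. pre_digraph.cycle (with_proj G) p \<and> 3 \<le> length p)"

text \<open>By symmetry, the out-degree counts the neighbours of a vertex.\<close>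

definition max_degree :: "'a pair_pre_digraph \<Rightarrow> nat" where
  "max_degree G = Max (out_degree (with_proj G) ` pverts G)"

definition edge_dist :: "'a pair_pre_digraph \<Rightarrow> 'a \<Rightarrow> 'a \<Rightarrow> nat" where
  "edge_dist G u v = (LEAST l. \<exists>p. pre_digraph.awalk (with_proj G) u p v \<and> length p = l)"

text \<open>\<open>v\<close> lies below \<open>r\<close>, or equals \<open>r\<close>, if \<open>r\<close> is on the path from the root \<open>\<rho>\<close> to \<open>v\<close>.\<close>

definition below :: "'a pair_pre_digraph \<Rightarrow> 'a \<Rightarrow> 'a \<Rightarrow> 'a \<Rightarrow> bool" where
  "below G \<rho> r v \<longleftrightarrow>
     (\<exists>p. pre_digraph.apath (with_proj G) \<rho> p v \<and> r \<in> set (pre_digraph.awalk_verts (with_proj G) \<rho> p))"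

definition subtree_block :: "'a pair_pre_digraph \<Rightarrow> 'a \<Rightarrow> nat \<Rightarrow> 'a \<Rightarrow> 'a set" where
  "subtree_block G \<rho> h r = {v \<in> pverts G. below G \<rho> r v \<and> edge_dist G r v \<le> h - 1}"

text \<open>The height of a block with top site \<open>r\<close> counts levels, so a single site has height 1.\<close>

definition block_height :: "'a pair_pre_digraph \<Rightarrow> 'a \<Rightarrow> 'a set \<Rightarrow> nat" where
  "block_height G r \<Theta> = Max (edge_dist G r ` \<Theta>) + 1"

definition subtree_block_cover ::
  "'a pair_pre_digraph \<Rightarrow> 'a \<Rightarrow> nat \<Rightarrow> 'a set list \<Rightarrow> bool" where
  "subtree_block_cover G \<rho> h \<Theta>s \<longleftrightarrow>
     (\<forall>\<Theta>\<in>set \<Theta>s. \<exists>r\<in>pverts G. \<Theta> = subtree_block G \<rho> h r \<and> h \<le> block_height G r \<Theta>) \<and>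
     \<Union>(set \<Theta>s) = pverts G"


section \<open>Markov chains on finite state spaces\<close>

text \<open>
  A transition matrix \<open>P\<close> is the kernel \<open>x \<mapsto> P(x, \<cdot>)\<close>. The matrix product \<open>P Q\<close>, in which \<open>P\<close> acts
  first, is composition of kernels, and \<open>return_pmf\<close> is the identity matrix.
\<close>

definition kernel_mult :: "('s \<Rightarrow> 's pmf) \<Rightarrow> ('s \<Rightarrow> 's pmf) \<Rightarrow> 's \<Rightarrow> 's pmf" where
  "kernel_mult P Q = (\<lambda>x. bind_pmf (P x) Q)"

definition kernel_prod :: "('s \<Rightarrow> 's pmf) list \<Rightarrow> 's \<Rightarrow> 's pmf" where
  "kernel_prod Ps = foldr kernel_mult Ps return_pmf"

definition kernel_power :: "('s \<Rightarrow> 's pmf) \<Rightarrow> nat \<Rightarrow> 's \<Rightarrow> 's pmf" where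
  "kernel_power P t = kernel_prod (replicate t P)"

definition tv_dist :: "'s set \<Rightarrow> 's pmf \<Rightarrow> 's pmf \<Rightarrow> real" where
  "tv_dist S \<mu> \<nu> = (\<Sum>i\<in>S. \<bar>pmf \<mu> i - pmf \<nu> i\<bar>) / 2"

text \<open>The infimum of the empty set is \<open>\<infinity>\<close>, so a finite mixing time asserts that \<open>\<epsilon>\<close> is reached.\<close>

definition mixing_time_from ::
  "'s set \<Rightarrow> ('s \<Rightarrow> 's pmf) \<Rightarrow> 's pmf \<Rightarrow> real \<Rightarrow> 's \<Rightarrow> enat" where
  "mixing_time_from S P \<pi> \<epsilon> x = Inf {enat t | t. 0 < t \<and> tv_dist S (kernel_power P t x) \<pi> \<le> \<epsilon>}"

definition mixing_time :: "'s set \<Rightarrow> ('s \<Rightarrow> 's pmf) \<Rightarrow> 's pmf \<Rightarrow> real \<Rightarrow> enat" where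
  "mixing_time S P \<pi> \<epsilon> = Max (mixing_time_from S P \<pi> \<epsilon> ` S)"


section \<open>Systematic scan on proper colourings\<close>

definition configurations :: "'a pair_pre_digraph \<Rightarrow> nat \<Rightarrow> ('a \<Rightarrow> nat) set" where
  "configurations G q = pverts G \<rightarrow>\<^sub>E {1..q}"

definition proper_colourings :: "'a pair_pre_digraph \<Rightarrow> nat \<Rightarrow> ('a \<Rightarrow> nat) set" where
  "proper_colourings G q = {x \<in> configurations G q. \<forall>(u, v)\<in>parcs G. x u \<noteq> x v}"

definition heat_bath :: "'a pair_pre_digraph \<Rightarrow> nat \<Rightarrow> 'a set \<Rightarrow> ('a \<Rightarrow> nat) \<Rightarrow> ('a \<Rightarrow> nat) pmf" where
  "heat_bath G q \<Theta> x = pmf_of_set {y \<in> configurations G q.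
     (\<forall>v \<in> pverts G - \<Theta>. y v = x v) \<and>
     (\<forall>(u, v)\<in>parcs G. u \<in> \<Theta> \<or> v \<in> \<Theta> \<longrightarrow> y u \<noteq> y v)}"

definition systematic_scan ::
  "'a pair_pre_digraph \<Rightarrow> nat \<Rightarrow> 'a set list \<Rightarrow> ('a \<Rightarrow> nat) \<Rightarrow> ('a \<Rightarrow> nat) pmf" where
  "systematic_scan G q \<Theta>s = kernel_prod (map (heat_bath G q) \<Theta>s)"

definition tree_h :: "nat \<Rightarrow> nat" where
  "tree_h \<Delta> = [15, 3, 12, 3, 7, 13, 85, 5] ! (\<Delta> - 3)"

definition tree_f :: "nat \<Rightarrow> nat" where
  "tree_f \<Delta> = [5, 7, 8, 10, 11, 12, 13, 15] ! (\<Delta> - 3)"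

end

theory Submission
  imports Defs
begin

text \<open>
  For a function \<open>f\<close> on all (not necessarily proper) configurations let \<open>d v\<close> bound the change of \<open>f\<close> when only
  the colour of \<open>v\<close> changes. A heat-bath move on a block \<open>\<Theta>\<close> removes the oscillation at the sites of
  \<open>\<Theta>\<close> and passes it on to the sites \<open>i\<close> around \<open>\<Theta>\<close>: since \<open>G\<close> is a tree, \<open>d j\<close> is passed to \<open>i\<close> with
  a factor of at most \<open>s ^ l\<close>, where \<open>l\<close> is the distance of \<open>i\<close> and \<open>j\<close> and \<open>s = 1 / (q - \<Delta>)\<close>. If weights
  \<open>w\<close> satisfy \<open>(\<Sum>i. w i * s ^ dist i j) \<le> \<alpha> * w j\<close> for every block and every site \<open>j\<close> in it, with
  \<open>\<alpha> < 1\<close>, a scan multiplies \<open>\<Sum>v. w v * d v\<close> by at most \<open>\<alpha>\<close>, and as the scan preserves the uniform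
  distribution on proper colourings, its total variation distance after \<open>t\<close> scans is at most
  \<open>\<alpha> ^ t * (\<Sum>v. w v)\<close> if all weights are at least \<open>1\<close>. The weights used here lie between \<open>1\<close> and \<open>n\<close>,
  so that \<open>O (ln (n / \<epsilon>))\<close> scans suffice.
\<close>

section \<open>Influence of a boundary site on a heat-bath move\<close>

text \<open>Why the weights work: \<open>weight \<xi> v\<close> is a sum over sites i, and the
  estimates inside a block can be read for one fixed i. A site then either lies on the path from the
  root to i (weight 1, parent also on the path, at most one child on it) or off it (each child has
  \<xi> times, the parent 1/\<xi> times its weight). The subtree size n v counts the i whose path
  contains v, and W v - n v collects all others; hence the pairs of coefficients, one for each case.
  Why the heights are what they are: with b = \<Delta> - 1 children and off the path, influence
  gains a factor s * b * \<xi> per level downwards and s / \<xi> per level upwards. Both are below 1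
  only for s < \<xi> < 1 / (s * b), which requires b * s^2 < 1. A bottom site of a block has
  boundary sites directly below it, which use up most of the available total; the term (s / \<xi>)^h
  from above the block must fit into the rest, and this asks for a large h when \<xi> has to be
  close to s.\<close>

definition simple_paths :: "'a rel \<Rightarrow> 'a set \<Rightarrow> 'a \<Rightarrow> 'a list set" where
  "simple_paths E \<Theta> i = {p. distinct (i # p) \<and> set p \<subseteq> \<Theta> \<and> successively (\<lambda>u v. (u, v) \<in> E) (i # p)}"

text \<open>Acyclicity in a form that survives the deletion of edges, as being a tree does not. It
  says that cutting an edge separates its two ends.\<close>

definition edge_is_only_path :: "'a rel \<Rightarrow> bool" where
  "edge_is_only_path E \<longleftrightarrow>
     (\<forall>i j p. (i, j) \<in> E \<longrightarrow> p \<in> simple_paths E UNIV i \<longrightarrow> last (i # p) = j \<longrightarrow> p = [j])"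

text \<open>The support of a heat-bath move, for an arbitrary edge relation because the influence
  bound deletes edges. Edges between two sites outside \<Theta> impose nothing, so x may be
  improper.\<close>

definition updates :: "'a set \<Rightarrow> 'a rel \<Rightarrow> nat \<Rightarrow> 'a set \<Rightarrow> ('a \<Rightarrow> nat) \<Rightarrow> ('a \<Rightarrow> nat) set" where
  "updates V E q \<Theta> x = {y \<in> V \<rightarrow>\<^sub>E {1..q}. (\<forall>v \<in> V - \<Theta>. y v = x v) \<and>
     (\<forall>(u, v)\<in>E. u \<in> \<Theta> \<or> v \<in> \<Theta> \<longrightarrow> y u \<noteq> y v)}"

definition mean :: "'s set \<Rightarrow> ('s \<Rightarrow> real) \<Rightarrow> real" where
  "mean A f = sum f A / real (card A)"

definition oscillation_bound :: "'a set \<Rightarrow> nat \<Rightarrow> (('a \<Rightarrow> nat) \<Rightarrow> real) \<Rightarrow> ('a \<Rightarrow> real) \<Rightarrow> bool" where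
  "oscillation_bound V q f d \<longleftrightarrow> (\<forall>v\<in>V. \<forall>x\<in>V \<rightarrow>\<^sub>E {1..q}. \<forall>y\<in>V \<rightarrow>\<^sub>E {1..q}.
     (\<forall>u. u \<noteq> v \<longrightarrow> x u = y u) \<longrightarrow> \<bar>f x - f y\<bar> \<le> d v)"

lemma oscillation_boundD:
  assumes "oscillation_bound V q f d" "v \<in> V" "x \<in> V \<rightarrow>\<^sub>E {1..q}" "y \<in> V \<rightarrow>\<^sub>E {1..q}"
    and "\<And>u. u \<noteq> v \<Longrightarrow> x u = y u"
  shows "\<bar>f x - f y\<bar> \<le> d v"
  using assms unfolding oscillation_bound_def by blast

lemma finite_simple_paths: "finite \<Theta> \<Longrightarrow> finite (simple_paths E \<Theta> i)"
  by (rule finite_subset[OF _ finite_subset_distinct[of \<Theta>]]) (auto simp: simple_paths_def)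

lemma simple_paths_mono: "E \<subseteq> E' \<Longrightarrow> \<Theta> \<subseteq> \<Theta>' \<Longrightarrow> simple_paths E \<Theta> i \<subseteq> simple_paths E' \<Theta>' i"
  unfolding simple_paths_def by (fastforce elim: successively_mono)

lemma Nil_in_simple_paths [simp]: "[] \<in> simple_paths E \<Theta> i"
  by (simp add: simple_paths_def)

lemma Cons_in_simple_paths:
  assumes "(i, j) \<in> E" "j \<in> \<Theta>" "i \<notin> \<Theta>" "p \<in> simple_paths E (\<Theta> - {j}) j"
  shows "j # p \<in> simple_paths E \<Theta> i"
  using assms by (auto simp: simple_paths_def)

lemma edge_is_only_path_mono: "edge_is_only_path E \<Longrightarrow> E' \<subseteq> E \<Longrightarrow> edge_is_only_path E'"
  using simple_paths_mono[of E' E UNIV UNIV] unfolding edge_is_only_path_def by blast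

lemma edge_is_only_path_irrefl: "edge_is_only_path E \<Longrightarrow> (i, i) \<notin> E"
  unfolding edge_is_only_path_def by (metis Nil_in_simple_paths last.simps list.discI)

lemma updatesI:
  assumes "y \<in> V \<rightarrow>\<^sub>E {1..q}" "\<And>v. v \<in> V \<Longrightarrow> v \<notin> \<Theta> \<Longrightarrow> y v = x v"
    and "\<And>u v. (u, v) \<in> E \<Longrightarrow> u \<in> \<Theta> \<or> v \<in> \<Theta> \<Longrightarrow> y u \<noteq> y v"
  shows "y \<in> updates V E q \<Theta> x"
  using assms unfolding updates_def by blast

lemma updatesD:
  assumes "y \<in> updates V E q \<Theta> x"
  shows "y \<in> V \<rightarrow>\<^sub>E {1..q}" "\<And>v. v \<in> V \<Longrightarrow> v \<notin> \<Theta> \<Longrightarrow> y v = x v"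
    and "\<And>u v. (u, v) \<in> E \<Longrightarrow> u \<in> \<Theta> \<or> v \<in> \<Theta> \<Longrightarrow> y u \<noteq> y v"
  using assms unfolding updates_def by blast+

lemma finite_updates: "finite V \<Longrightarrow> finite (updates V E q \<Theta> x)"
  unfolding updates_def by (simp add: finite_PiE)

lemma updates_cong:
  assumes "\<And>v. v \<in> V - \<Theta> \<Longrightarrow> x v = y v"
  shows "updates V E q \<Theta> x = updates V E q \<Theta> y"
  using assms unfolding updates_def by auto

lemma exists_free_colour:
  assumes "finite N" "card N < q"
  shows "\<exists>c\<in>{1..q}. c \<notin> y ` N"
proof (rule ccontr)
  assume "\<not> ?thesis"
  then have "{1..q} \<subseteq> y ` N" by auto
  then have "card {1..q} \<le> card N"
    by (meson assms(1) card_image_le card_mono finite_imageI le_trans)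
  then show False using assms(2) by simp
qed

text \<open>Greedy colouring: a site that joins the block is recoloured to avoid its fewer than q
  neighbours, frozen or not, so no boundary condition can obstruct a move.\<close>

lemma updates_nonempty:
  assumes fin: "finite V" and EV: "E \<subseteq> V \<times> V" and symE: "sym E" and only: "\<And>v. (v, v) \<notin> E"
    and deg: "\<And>v. card (E `` {v}) < q" and "\<Theta> \<subseteq> V" and x: "x \<in> V \<rightarrow>\<^sub>E {1..q}"
  shows "updates V E q \<Theta> x \<noteq> {}"
proof -
  have "finite \<Theta>" using \<open>\<Theta> \<subseteq> V\<close> fin finite_subset by blast
  then show ?thesis using \<open>\<Theta> \<subseteq> V\<close>
  proof (induction \<Theta> rule: finite_induct)
    case empty
    then show ?case using x by (auto simp: updates_def)
  next
    case (insert j \<Theta>)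
    then obtain y where y: "y \<in> updates V E q \<Theta> x" by auto
    have "finite (E `` {j})" by (rule finite_subset[OF _ fin]) (use EV in auto)
    then obtain c where c: "c \<in> {1..q}" "c \<notin> y ` (E `` {j})"
      using exists_free_colour deg by metis
    let ?y = "y(j := c)"
    have "?y \<in> updates V E q (insert j \<Theta>) x"
    proof (rule updatesI)
      show "?y \<in> V \<rightarrow>\<^sub>E {1..q}"
        using updatesD(1)[OF y] c insert.prems by (auto simp: PiE_iff extensional_def)
      show "?y v = x v" if "v \<in> V" "v \<notin> insert j \<Theta>" for v
        using that updatesD(2)[OF y] by auto
      show "?y u \<noteq> ?y v" if uv: "(u, v) \<in> E" "u \<in> insert j \<Theta> \<or> v \<in> insert j \<Theta>" for u v
      proof (cases "u = j \<or> v = j")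
        case True
        then show ?thesis using uv c(2) only symD[OF symE] by (auto simp: image_iff)
      next
        case False
        then show ?thesis using uv updatesD(3)[OF y] by auto
      qed
    qed
    then show ?case by auto
  qed
qed

text \<open>Conditioning the same distribution \<open>\<nu>\<close> on avoiding the colour \<open>a\<close> or the colour \<open>b\<close>: the two
  conditional distributions differ by moving mass onto a single colour.\<close>

lemma conditional_mean_diff:
  fixes \<nu> F :: "'c \<Rightarrow> real"
  assumes fin: "finite C" and nn: "\<And>c. c \<in> C \<Longrightarrow> 0 \<le> \<nu> c" and one: "sum \<nu> C = 1"
    and a: "a \<in> C" and b: "b \<in> C" and s: "0 \<le> s" "s * (1 - \<nu> a) \<ge> \<nu> a" "\<nu> a < 1"
    and le: "\<nu> b \<le> \<nu> a" and osc: "\<And>c c'. c \<in> C \<Longrightarrow> c' \<in> C \<Longrightarrow> \<bar>F c - F c'\<bar> \<le> D"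
  shows "\<bar>(\<Sum>c\<in>C - {a}. \<nu> c * F c) / (1 - \<nu> a) - (\<Sum>c\<in>C - {b}. \<nu> c * F c) / (1 - \<nu> b)\<bar> \<le> s * D"
proof -
  have D: "0 \<le> D" using osc[OF a a] by simp
  define \<mu> where "\<mu> z c = (if c = z then 0 else \<nu> c / (1 - \<nu> z))" for z c
  have mu_mean: "(\<Sum>c\<in>C - {z}. \<nu> c * F' c) / (1 - \<nu> z) = (\<Sum>c\<in>C. \<mu> z c * F' c)" if "z \<in> C" for z F'
  proof -
    have "(\<Sum>c\<in>C. \<mu> z c * F' c) = (\<Sum>c\<in>C - {z}. \<mu> z c * F' c)"
      using fin that by (subst sum.remove[of _ z]) (auto simp: \<mu>_def)
    also have "\<dots> = (\<Sum>c\<in>C - {z}. \<nu> c * F' c) / (1 - \<nu> z)"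
      unfolding sum_divide_distrib by (rule sum.cong) (auto simp: \<mu>_def)
    finally show ?thesis by simp
  qed
  have b1: "\<nu> b < 1" using le s by linarith
  have mu1: "(\<Sum>c\<in>C. \<mu> z c) = 1" if "z \<in> C" "\<nu> z < 1" for z
  proof -
    have "sum \<nu> (C - {z}) = 1 - \<nu> z" using fin that one by (simp add: sum_diff1)
    then show ?thesis using mu_mean[OF that(1), of "\<lambda>_. 1"] that by simp
  qed
  have ge: "\<mu> b c \<le> \<mu> a c" if "c \<in> C" "c \<noteq> a" for c
    using that nn[OF that(1)] le s by (auto simp: \<mu>_def intro!: divide_left_mono mult_pos_pos)
  \<comment> \<open>Both \<open>\<mu> a\<close> and \<open>\<mu> b\<close> have mass 1, so F may be
    shifted by the constant F a. This removes c = a, the only colour at which \<open>\<mu> a\<close>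
    can be smaller than \<open>\<mu> b\<close>.\<close>
  have "(\<Sum>c\<in>C. \<mu> a c * F c) - (\<Sum>c\<in>C. \<mu> b c * F c) = (\<Sum>c\<in>C. (\<mu> a c - \<mu> b c) * (F c - F a))"
    using mu1[OF a s(3)] mu1[OF b b1]
    by (simp add: algebra_simps sum.distrib sum_subtractf flip: sum_distrib_left sum_distrib_right)
  also have "\<dots> = (\<Sum>c\<in>C - {a}. (\<mu> a c - \<mu> b c) * (F c - F a))"
    using fin a by (subst sum.remove[of _ a]) auto
  also have "\<bar>\<dots>\<bar> \<le> (\<Sum>c\<in>C - {a}. (\<mu> a c - \<mu> b c) * D)"
    by (intro order.trans[OF sum_abs] sum_mono)
      (use ge osc a in \<open>auto simp: abs_mult intro!: mult_mono\<close>)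
  also have "\<dots> = (sum (\<mu> a) (C - {a}) - sum (\<mu> b) (C - {a})) * D"
    by (simp add: sum_subtractf flip: sum_distrib_right)
  also have "sum (\<mu> a) (C - {a}) - sum (\<mu> b) (C - {a}) = \<mu> b a"
    using fin a mu1[OF a s(3)] mu1[OF b b1] by (simp add: sum_diff1) (simp add: \<mu>_def)
  also have "\<mu> b a \<le> s"
  proof -
    have "\<nu> a / (1 - \<nu> b) \<le> \<nu> a / (1 - \<nu> a)"
      using le s nn[OF a] b1 by (intro divide_left_mono) auto
    also have "\<dots> \<le> s" using s by (simp add: divide_simps mult.commute)
    finally show ?thesis using s by (auto simp: \<mu>_def)
  qed
  finally show ?thesis using D by (simp add: mu_mean a b mult_right_mono)
qed

text \<open>Each update with colour a at j yields at least q - k updates by recolouring j alone, and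
  can be recovered from any of them because its colour at j was a. So no colour at j is likelier
  than 1 / (q - k).\<close>

lemma card_updates_colour_le:
  assumes fin: "finite V" and EV: "E \<subseteq> V \<times> V" and symE: "sym E" and irr: "\<And>v. (v, v) \<notin> E"
    and j: "j \<in> \<Theta>" "j \<in> V" and deg: "card (E `` {j}) \<le> k"
  shows "(q - k) * card {y \<in> updates V E q \<Theta> x. y j = a} \<le> card (updates V E q \<Theta> x)"
proof -
  define W where "W = {y \<in> updates V E q \<Theta> x. y j = a}"
  define S where "S = (SIGMA y:W. {1..q} - y ` (E `` {j}))"
  have finW: "finite W" unfolding W_def using finite_updates[OF fin] by simp
  have finN: "finite (E `` {j})" by (rule finite_subset[OF _ fin]) (use EV in auto)
  have "(q - k) * card W = (\<Sum>y\<in>W. q - k)" by simp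
  also have "\<dots> \<le> (\<Sum>y\<in>W. card ({1..q} - y ` (E `` {j})))"
  proof (rule sum_mono)
    fix y assume "y \<in> W"
    have "card (y ` (E `` {j})) \<le> k" using card_image_le[OF finN] deg le_trans by blast
    then have "q - k \<le> card {1..q} - card (y ` (E `` {j}))" by simp
    also have "\<dots> \<le> card ({1..q} - y ` (E `` {j}))"
      using finN by (intro diff_card_le_card_Diff) auto
    finally show "q - k \<le> card ({1..q} - y ` (E `` {j}))" .
  qed
  also have "\<dots> = card S" unfolding S_def using finW by (subst card_SigmaI) auto
  also have "\<dots> \<le> card (updates V E q \<Theta> x)"
  proof (rule card_inj_on_le[OF _ _ finite_updates[OF fin]])
    show "inj_on (\<lambda>(y, c). y(j := c)) S"
    proof (rule inj_onI, clarify)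
      fix y c y' c' assume *: "(y, c) \<in> S" "(y', c') \<in> S" "y(j := c) = y'(j := c')"
      then have "y j = y' j" by (auto simp: S_def W_def)
      moreover have "y u = y' u" if "u \<noteq> j" for u using fun_cong[OF *(3), of u] that by simp
      ultimately have "y = y'" by (metis ext)
      moreover have "c = c'" using fun_cong[OF *(3), of j] by simp
      ultimately show "y = y' \<and> c = c'" by simp
    qed
    show "(\<lambda>(y, c). y(j := c)) ` S \<subseteq> updates V E q \<Theta> x"
    proof clarify
      fix y c assume "(y, c) \<in> S"
      then have y: "y \<in> updates V E q \<Theta> x" and c: "c \<in> {1..q}" "c \<notin> y ` (E `` {j})"
        by (auto simp: S_def W_def)
      show "y(j := c) \<in> updates V E q \<Theta> x"
      proof (rule updatesI)
        show "y(j := c) \<in> V \<rightarrow>\<^sub>E {1..q}"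
          using updatesD(1)[OF y] c j by (auto simp: PiE_iff extensional_def)
        show "(y(j := c)) v = x v" if "v \<in> V" "v \<notin> \<Theta>" for v
          using that j updatesD(2)[OF y that] by auto
        show "(y(j := c)) u \<noteq> (y(j := c)) v" if uv: "(u, v) \<in> E" "u \<in> \<Theta> \<or> v \<in> \<Theta>" for u v
          using uv c(2) irr symD[OF symE] updatesD(3)[OF y uv] by (auto simp: image_iff)
      qed
    qed
  qed
  finally show ?thesis unfolding W_def .
qed

section \<open>Conditioning a block move on the colour of one site\<close>

lemma updates_remove_edge:
  assumes "(i, j) \<in> E" "i \<in> V" "i \<notin> \<Theta>" "j \<in> \<Theta>"
  shows "updates V E q \<Theta> x = {y \<in> updates V (E - {(i, j), (j, i)}) q \<Theta> x. y j \<noteq> x i}" (is "?L = ?R")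
proof (intro equalityI subsetI)
  fix y assume y: "y \<in> ?L"
  have "y i \<noteq> y j" using updatesD(3)[OF y, of i j] assms by blast
  moreover have "y i = x i" using updatesD(2)[OF y] assms by blast
  ultimately show "y \<in> ?R" using y unfolding updates_def by auto
next
  fix y assume R: "y \<in> ?R"
  then have y: "y \<in> updates V (E - {(i, j), (j, i)}) q \<Theta> x" and ne: "y j \<noteq> y i"
    using updatesD(2)[of y V _ q \<Theta> x i] assms by auto
  show "y \<in> ?L"
    using updatesD(1,2)[OF y] updatesD(3)[OF y] ne by (intro updatesI) (blast, blast, fastforce)
qed

lemma updates_fix_colour:
  assumes "j \<in> \<Theta>" "j \<in> V" "y \<in> updates V E q \<Theta> x" "y j = c"
  shows "{z \<in> updates V E q \<Theta> x. z j = c} = updates V E q (\<Theta> - {j}) (x(j := c))" (is "?L = ?R")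
proof (intro equalityI subsetI)
  fix z assume "z \<in> ?L"
  then have z: "z \<in> updates V E q \<Theta> x" "z j = c" by auto
  show "z \<in> ?R" using updatesD[OF z(1)] z(2) by (intro updatesI) auto
next
  fix z assume z: "z \<in> ?R"
  have zj: "z j = c" using updatesD(2)[OF z, of j] assms by auto
  have zv: "z v = x v" if "v \<in> V" "v \<notin> \<Theta>" for v
    using updatesD(2)[OF z, of v] assms that by auto
  have out: "z v = y v" if "v \<notin> \<Theta>" for v
  proof (cases "v \<in> V")
    case True
    then show ?thesis using zv that updatesD(2)[OF assms(3)] by auto
  next
    case False
    then show ?thesis using updatesD(1)[OF z] updatesD(1)[OF assms(3)]
      by (auto simp: PiE_iff extensional_def)
  qed
  have "z u \<noteq> z v" if uv: "(u, v) \<in> E" "u \<in> \<Theta> \<or> v \<in> \<Theta>" for u v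
  proof (cases "u \<in> \<Theta> - {j} \<or> v \<in> \<Theta> - {j}")
    case True
    then show ?thesis using updatesD(3)[OF z uv(1)] by auto
  next
    case False
    then have "z u = y u" "z v = y v" using out zj assms(4) by auto
    then show ?thesis using updatesD(3)[OF assms(3) uv] by simp
  qed
  then show "z \<in> ?L" using updatesD(1)[OF z] zv zj by (auto intro!: updatesI)
qed

text \<open>Total expectation over the colour c of j. With the edge between i and j removed, c has
  law \<nu>; the edge conditions it on c \<noteq> x i; given c, the rest is a move on \<Theta> - {j}
  with j frozen.\<close>

lemma mean_updates_condition:
  fixes f :: "('a \<Rightarrow> nat) \<Rightarrow> real" and x :: "'a \<Rightarrow> nat" and q :: nat
  assumes fin: "finite V" and edge: "(i, j) \<in> E" and i: "i \<in> V" "i \<notin> \<Theta>" and j: "j \<in> \<Theta>" "j \<in> V"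
  defines "U \<equiv> updates V (E - {(i, j), (j, i)}) q \<Theta> x"
  defines "\<nu> \<equiv> \<lambda>c. mean U (\<lambda>y. of_bool (y j = c))"
  assumes ne: "U \<noteq> {}"
  shows "mean (updates V E q \<Theta> x) f =
    (\<Sum>c\<in>{1..q} - {x i}. \<nu> c * mean (updates V E q (\<Theta> - {j}) (x(j := c))) f) / (1 - \<nu> (x i))"
proof -
  have finU: "finite U" unfolding U_def by (rule finite_updates[OF fin])
  define N where "N = real (card U)"
  have N: "N > 0" using ne finU by (simp add: N_def card_gt_0_iff)
  define Uc where "Uc c = {y \<in> U. y j = c}" for c
  have nu: "\<nu> c = card (Uc c) / N" for c
  proof -
    have "(\<Sum>y\<in>U. of_bool (y j = c)) = (\<Sum>y\<in>Uc c. (1::real))"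
      unfolding Uc_def using finU by (intro sum.mono_neutral_cong_right) auto
    then show ?thesis by (simp add: \<nu>_def mean_def N_def)
  qed
  have L: "updates V E q \<Theta> x = {y \<in> U. y j \<noteq> x i}" (is "?L = _")
    unfolding U_def by (rule updates_remove_edge) fact+
  have "?L = U - Uc (x i)" unfolding L Uc_def by auto
  then have cardL: "real (card ?L) = N * (1 - \<nu> (x i))"
    using finU N by (simp add: nu N_def Uc_def card_Diff_subset card_mono of_nat_diff field_simps)
  have range: "y j \<in> {1..q}" if "y \<in> U" for y
    using updatesD(1)[OF that[unfolded U_def]] j by auto
  have part: "sum f (Uc c) = N * \<nu> c * mean (updates V E q (\<Theta> - {j}) (x(j := c))) f"
    if c: "c \<noteq> x i" for c
  \<comment> \<open>If no update gives j the colour c, then \<nu> c = 0 and the mean on the right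
    does not matter. Otherwise there is a witness for \<open>updates_fix_colour\<close>.\<close>
  proof (cases "Uc c = {}")
    case True
    then show ?thesis by (simp add: nu)
  next
    case False
    then obtain y where y: "y \<in> ?L" "y j = c" unfolding L using c by (auto simp: Uc_def)
    have "Uc c = {z \<in> ?L. z j = c}" unfolding L Uc_def using c by auto
    also have "\<dots> = updates V E q (\<Theta> - {j}) (x(j := c))"
      by (rule updates_fix_colour[OF j y])
    finally have "mean (updates V E q (\<Theta> - {j}) (x(j := c))) f = sum f (Uc c) / card (Uc c)"
      by (simp add: mean_def)
    moreover have "card (Uc c) \<noteq> 0" using False finU by (simp add: Uc_def)
    ultimately show ?thesis using N by (simp add: nu)
  qed
  have "sum f ?L = (\<Sum>c\<in>{1..q} - {x i}. sum f {y \<in> ?L. y j = c})"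
    by (rule sum.group[symmetric]) (use finU range in \<open>auto simp: L\<close>)
  also have "\<dots> = (\<Sum>c\<in>{1..q} - {x i}. sum f (Uc c))"
    by (intro sum.cong refl arg_cong2[of _ _ _ _ sum]) (auto simp: L Uc_def)
  also have "\<dots> = N * (\<Sum>c\<in>{1..q} - {x i}. \<nu> c * mean (updates V E q (\<Theta> - {j}) (x(j := c))) f)"
    unfolding sum_distrib_left by (intro sum.cong refl) (auto simp: part)
  finally show ?thesis unfolding mean_def[of ?L] cardL using N by simp
qed

text \<open>No constraint of the move involves i, so recolouring i is a bijection between the two
  sets of updates, and only the direct effect d i remains. This is the empty path in the influence
  bound.\<close>

lemma mean_updates_no_neighbour:
  assumes fin: "finite V" and symE: "sym E" and i: "i \<in> V" "i \<notin> \<Theta>"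
    and nbr: "\<And>j. (i, j) \<in> E \<Longrightarrow> j \<notin> \<Theta>"
    and x: "x \<in> V \<rightarrow>\<^sub>E {1..q}" and y: "y \<in> V \<rightarrow>\<^sub>E {1..q}" and xy: "\<And>u. u \<noteq> i \<Longrightarrow> x u = y u"
    and ne: "updates V E q \<Theta> x \<noteq> {}" and osc: "oscillation_bound V q f d"
  shows "\<bar>mean (updates V E q \<Theta> x) f - mean (updates V E q \<Theta> y) f\<bar> \<le> d i"
proof -
  have upd: "(\<lambda>z. z(i := y i)) ` updates V E q \<Theta> x \<subseteq> updates V E q \<Theta> y"
    if "x \<in> V \<rightarrow>\<^sub>E {1..q}" "y \<in> V \<rightarrow>\<^sub>E {1..q}" "\<And>u. u \<noteq> i \<Longrightarrow> x u = y u" for x y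
  proof clarify
    fix z assume z: "z \<in> updates V E q \<Theta> x"
    show "z(i := y i) \<in> updates V E q \<Theta> y"
    proof (rule updatesI)
      show "z(i := y i) \<in> V \<rightarrow>\<^sub>E {1..q}"
        using updatesD(1)[OF z] that(2) i by (auto simp: PiE_iff extensional_def)
      show "(z(i := y i)) v = y v" if "v \<in> V" "v \<notin> \<Theta>" for v
        using updatesD(2)[OF z that] \<open>\<And>u. u \<noteq> i \<Longrightarrow> x u = y u\<close> by auto
      show "(z(i := y i)) u \<noteq> (z(i := y i)) v" if uv: "(u, v) \<in> E" "u \<in> \<Theta> \<or> v \<in> \<Theta>" for u v
      proof -
        have "u \<noteq> i" "v \<noteq> i" using uv nbr symD[OF symE] i(2) by blast+
        then show ?thesis using updatesD(3)[OF z uv] by simp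
      qed
    qed
  qed
  let ?X = "updates V E q \<Theta> x" and ?Y = "updates V E q \<Theta> y" and ?g = "\<lambda>z. z(i := y i)"
  have zx: "z i = x i" if "z \<in> ?X" for z using updatesD(2)[OF that] i by blast
  have zy: "z i = y i" if "z \<in> ?Y" for z using updatesD(2)[OF that] i by blast
  have inj: "inj_on ?g ?X" by (rule inj_onI) (metis fun_upd_triv fun_upd_upd zx)
  have "?Y \<subseteq> ?g ` ?X"
  proof
    fix z assume z: "z \<in> ?Y"
    then have "z(i := x i) \<in> ?X" using upd[OF y x] xy by auto
    moreover have "z = ?g (z(i := x i))" using zy[OF z] by auto
    ultimately show "z \<in> ?g ` ?X" by blast
  qed
  with upd[OF x y xy] have Y: "?Y = ?g ` ?X" by auto
  have N: "real (card ?X) > 0" using ne finite_updates[OF fin] by (simp add: card_gt_0_iff)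
  have "mean ?X f - mean ?Y f = (\<Sum>z\<in>?X. f z - f (?g z)) / card ?X"
    unfolding Y mean_def card_image[OF inj] sum.reindex[OF inj]
    by (simp add: diff_divide_distrib sum_subtractf)
  also have "\<bar>\<dots>\<bar> \<le> (\<Sum>z\<in>?X. d i) / card ?X"
  proof -
    have "\<bar>f z - f (?g z)\<bar> \<le> d i" if z: "z \<in> ?X" for z
    proof (rule oscillation_boundD[OF osc i(1) updatesD(1)[OF z]])
      have "?g z \<in> ?Y" using Y z by blast
      then show "?g z \<in> V \<rightarrow>\<^sub>E {1..q}" by (rule updatesD(1))
    qed auto
    then have "\<bar>\<Sum>z\<in>?X. f z - f (?g z)\<bar> \<le> (\<Sum>z\<in>?X. d i)"
      by (intro order.trans[OF sum_abs] sum_mono)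
    then show ?thesis using N by (simp add: abs_divide divide_right_mono del: sum_constant)
  qed
  also have "\<dots> = d i" using N by simp
  finally show ?thesis .
qed

text \<open>Deleting the edge from \<open>i\<close> to a neighbour \<open>j\<close> in the block makes the distribution of the
  colour of \<open>j\<close> independent of the colour of \<open>i\<close>; this is the induction hypothesis for the smaller
  edge set. Restoring the edge conditions that distribution on avoiding the colour of \<open>i\<close>.\<close>

theorem mean_updates_influence:
  fixes s :: real
  assumes fin: "finite V" and "E \<subseteq> V \<times> V" and "sym E" and "edge_is_only_path E"
    and "\<And>v. card (E `` {v}) \<le> \<Delta>" and q: "\<Delta> < q" and s: "s = 1 / (real q - real \<Delta>)"
    and "\<Theta> \<subseteq> V" and "i \<in> V" "i \<notin> \<Theta>"
    and "x \<in> V \<rightarrow>\<^sub>E {1..q}" and "y \<in> V \<rightarrow>\<^sub>E {1..q}" and "\<And>u. u \<noteq> i \<Longrightarrow> x u = y u"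
    and "oscillation_bound V q f d" and "\<And>v. 0 \<le> d v"
  shows "\<bar>mean (updates V E q \<Theta> x) f - mean (updates V E q \<Theta> y) f\<bar>
    \<le> (\<Sum>p\<in>simple_paths E \<Theta> i. s ^ length p * d (last (i # p)))"
  using assms(2-5,8-)
\<comment> \<open>Two kinds of smaller instances occur: the same block with one edge deleted, and
  the same edges with one site taken out of the block.\<close>
proof (induction "card E + card \<Theta>" arbitrary: E \<Theta> i x y f d rule: less_induct)
  case less
  note EV = less.prems(1) and symE = less.prems(2) and only = less.prems(3) and deg = less.prems(4)
  note TV = less.prems(5) and iV = less.prems(6) and iT = less.prems(7)
  note x = less.prems(8) and y = less.prems(9) and xy = less.prems(10) and osc = less.prems(11)
  note d = less.prems(12)
  have s0: "0 \<le> s" using q s by simp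
  have finE: "finite E" using EV fin finite_subset by blast
  have finT: "finite \<Theta>" using TV fin finite_subset by blast
  have finP: "finite (simple_paths E \<Theta> i)" by (rule finite_simple_paths[OF finT])
  have irr: "(v, v) \<notin> E" for v using edge_is_only_path_irrefl[OF only] .
  show ?case
  proof (cases "\<exists>j. (i, j) \<in> E \<and> j \<in> \<Theta>")
    case False
    have "updates V E q \<Theta> x \<noteq> {}"
      by (rule updates_nonempty[OF fin EV symE irr le_less_trans[OF deg q] TV x])
    then have "\<bar>mean (updates V E q \<Theta> x) f - mean (updates V E q \<Theta> y) f\<bar> \<le> d i"
      using False by (intro mean_updates_no_neighbour[OF fin symE iV iT _ x y xy _ osc]) auto
    also have "\<dots> = (\<Sum>p\<in>{[]}. s ^ length p * d (last (i # p)))" by simp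
    also have "\<dots> \<le> (\<Sum>p\<in>simple_paths E \<Theta> i. s ^ length p * d (last (i # p)))"
      by (rule sum_mono2[OF finP]) (use s0 d in auto)
    finally show ?thesis .
  next
    case True
    then obtain j where ij: "(i, j) \<in> E" and jT: "j \<in> \<Theta>" by blast
    have jV: "j \<in> V" using jT TV by blast
    have ne_ij: "i \<noteq> j" using iT jT by blast
    define E' where "E' = E - {(i, j), (j, i)}"
    define \<Theta>' where "\<Theta>' = \<Theta> - {j}"
    have E': "E' \<subseteq> V \<times> V" "sym E'" "edge_is_only_path E'"
      using EV symE only edge_is_only_path_mono[OF only, of E'] by (auto simp: E'_def sym_def)
    have deg': "card (E' `` {v}) \<le> \<Delta>" for v
    proof -
      have "finite (E `` {v})" by (rule finite_subset[OF _ fin]) (use EV in auto)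
      then have "card (E' `` {v}) \<le> card (E `` {v})" by (rule card_mono) (auto simp: E'_def)
      then show ?thesis using deg le_trans by blast
    qed
    have "card E' < card E" unfolding E'_def using ij finE by (intro psubset_card_mono) auto
    note IH_E = less.hyps[OF _ E' deg' TV iV iT, unfolded add_less_cancel_right, OF this]
    have "card \<Theta>' < card \<Theta>" unfolding \<Theta>'_def using jT finT by (intro card_Diff1_less)
    then have card': "card E + card \<Theta>' < card E + card \<Theta>" by simp
    have TV': "\<Theta>' \<subseteq> V" and iT': "i \<notin> \<Theta>'" and jT': "j \<notin> \<Theta>'" using TV iT by (auto simp: \<Theta>'_def)
    note IH_T = less.hyps[OF card' EV symE only deg TV']
    define U where "U z = updates V E' q \<Theta> z" for z
    have neU: "U z \<noteq> {}" if "z \<in> V \<rightarrow>\<^sub>E {1..q}" for z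
      unfolding U_def
      by (rule updates_nonempty[OF fin E'(1,2) _ le_less_trans[OF deg' q] TV that])
        (use irr in \<open>auto simp: E'_def\<close>)
    have finU: "finite (U z)" for z unfolding U_def by (rule finite_updates[OF fin])
    define \<nu> where "\<nu> z c = mean (U z) (\<lambda>z. of_bool (z j = c))" for z c
    \<comment> \<open>The induction hypothesis is applied to the indicator of colour c at j, which
      oscillates by 1 at j and by 0 elsewhere. No path leads from i to j once their edge is
      cut.\<close>
    have nu_eq: "\<nu> x c = \<nu> y c" for c
    proof -
      have "\<bar>\<nu> x c - \<nu> y c\<bar> \<le> (\<Sum>p\<in>simple_paths E' \<Theta> i. s ^ length p * of_bool (last (i # p) = j))"
        unfolding \<nu>_def U_def
        by (rule IH_E[OF x y xy]) (auto simp: oscillation_bound_def)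
      also have "\<dots> = 0"
      proof (rule sum.neutral, rule ballI)
        fix p assume p: "p \<in> simple_paths E' \<Theta> i"
        have "last (i # p) \<noteq> j"
        proof
          assume "last (i # p) = j"
          moreover have "p \<in> simple_paths E UNIV i"
            using p simple_paths_mono[of E' E \<Theta> UNIV i] by (auto simp: E'_def)
          ultimately have "p = [j]" using only ij unfolding edge_is_only_path_def by blast
          then show False using p by (auto simp: simple_paths_def E'_def)
        qed
        then show "s ^ length p * of_bool (last (i # p) = j) = 0" by simp
      qed
      finally show ?thesis by simp
    qed
    have nu_nn: "0 \<le> \<nu> x c" for c by (simp add: \<nu>_def mean_def sum_nonneg)
    have card_U: "real (card (U x)) > 0" using neU[OF x] finU by (simp add: card_gt_0_iff)
    have nu_card: "\<nu> x c = card {z \<in> U x. z j = c} / card (U x)" for c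
    proof -
      have "(\<Sum>z\<in>U x. of_bool (z j = c)) = (\<Sum>z\<in>{z \<in> U x. z j = c}. (1::real))"
        using finU by (intro sum.mono_neutral_cong_right) auto
      then show ?thesis by (simp add: \<nu>_def mean_def)
    qed
    have nu_one: "sum (\<nu> x) {1..q} = 1"
    proof -
      have "sum (\<nu> x) {1..q} = (\<Sum>z\<in>U x. \<Sum>c\<in>{1..q}. of_bool (z j = c)) / card (U x)"
        unfolding \<nu>_def mean_def sum_divide_distrib[symmetric] by (subst sum.swap) simp
      also have "(\<Sum>z\<in>U x. \<Sum>c\<in>{1..q}. of_bool (z j = c)) = (\<Sum>z\<in>U x. (1::real))"
      proof (rule sum.cong[OF refl])
        fix z assume "z \<in> U x"
        then have "z j \<in> {1..q}" using PiE_mem[OF updatesD(1) jV] unfolding U_def by blast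
        then show "(\<Sum>c\<in>{1..q}. of_bool (z j = c)) = (1::real)"
          by (simp add: of_bool_def sum.delta)
      qed
      finally show ?thesis using card_U by simp
    qed
    \<comment> \<open>The origin of s: without i, site j has at most \<Delta> - 1 neighbours and so
      at least q - \<Delta> + 1 free colours. Hence \<nu> \<le> 1 / (q - \<Delta> + 1), that is,
      \<nu> / (1 - \<nu>) \<le> 1 / (q - \<Delta>).\<close>
    have nu_le: "\<nu> x c \<le> s * (1 - \<nu> x c)" and nu_less: "\<nu> x c < 1" for c
    proof -
      have nbrs: "E' `` {j} = E `` {j} - {i}" using ne_ij by (auto simp: E'_def)
      have "i \<in> E `` {j}" using ij symE by (auto dest: symD)
      moreover have "finite (E `` {j})" by (rule finite_subset[OF _ fin]) (use EV in auto)
      ultimately have "card (E' `` {j}) = card (E `` {j}) - 1" "card (E `` {j}) > 0"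
        unfolding nbrs by (auto simp: card_gt_0_iff)
      with deg[of j] have k: "card (E' `` {j}) \<le> \<Delta> - 1" "1 \<le> \<Delta>" by linarith+
      have "(q - (\<Delta> - 1)) * card {z \<in> U x. z j = c} \<le> card (U x)"
        unfolding U_def
        by (rule card_updates_colour_le[OF fin E'(1,2) _ jT jV k(1)]) (use irr in \<open>auto simp: E'_def\<close>)
      then have "real (q - (\<Delta> - 1)) * real (card {z \<in> U x. z j = c}) \<le> real (card (U x))"
        unfolding of_nat_mult[symmetric] of_nat_le_iff .
      then have "real (q - (\<Delta> - 1)) * \<nu> x c \<le> 1"
        unfolding nu_card times_divide_eq_right pos_divide_le_eq[OF card_U] by simp
      moreover have eq: "real (q - (\<Delta> - 1)) = real q - real \<Delta> + 1" using k q by linarith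
      ultimately have *: "(real q - real \<Delta> + 1) * \<nu> x c \<le> 1" unfolding eq by blast
      have t: "1 \<le> real q - real \<Delta>" using q by linarith
      show "\<nu> x c \<le> s * (1 - \<nu> x c)" 
        using * t unfolding s by (simp add: pos_le_divide_eq algebra_simps)
      have "2 * \<nu> x c \<le> (real q - real \<Delta> + 1) * \<nu> x c" using t nu_nn by (intro mult_right_mono) auto
      then show "\<nu> x c < 1" using * by linarith
    qed
    define F where "F z c = mean (updates V E q \<Theta>' (z(j := c))) f" for z c
    have split: "mean (updates V E q \<Theta> z) f = (\<Sum>c\<in>{1..q} - {z i}. \<nu> z c * F z c) / (1 - \<nu> z (z i))"
      if "z \<in> V \<rightarrow>\<^sub>E {1..q}" for z
      using mean_updates_condition[OF fin ij iV iT jT jV neU[OF that, unfolded U_def E'_def], of f]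
      unfolding F_def \<nu>_def U_def E'_def \<Theta>'_def .
    have recol: "z(j := c) \<in> V \<rightarrow>\<^sub>E {1..q}" if "z \<in> V \<rightarrow>\<^sub>E {1..q}" "c \<in> {1..q}" for z c
      using that jV by (auto simp: PiE_iff extensional_def)
    define B where "B i = (\<Sum>p\<in>simple_paths E \<Theta>' i. s ^ length p * d (last (i # p)))" for i
    have F_xy: "\<bar>F x c - F y c\<bar> \<le> B i" if "c \<in> {1..q}" for c
      unfolding F_def B_def
      by (rule IH_T[OF iV iT' recol[OF x that] recol[OF y that] _ osc d]) (use xy in auto)
    \<comment> \<open>Now j, frozen outside \<Theta> - {j}, is the boundary site whose colour
      changes.\<close>
    have F_cc: "\<bar>F y c - F y c'\<bar> \<le> B j" if "c \<in> {1..q}" "c' \<in> {1..q}" for c c'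
      unfolding F_def B_def
      by (rule IH_T[OF jV jT' recol[OF y that(1)] recol[OF y that(2)] _ osc d]) auto
    have xi: "x i \<in> {1..q}" and yi: "y i \<in> {1..q}" using x y iV by auto
    \<comment> \<open>The change from x to y is made in two stages: first in the boundary condition
      of the smaller block, with j still conditioned on avoiding x i, then in the conditioning. They
      account for the paths from i that avoid j and for those that begin with the edge to j.\<close>
    have first: "\<bar>(\<Sum>c\<in>{1..q} - {x i}. \<nu> x c * F x c) / (1 - \<nu> x (x i))
        - (\<Sum>c\<in>{1..q} - {x i}. \<nu> x c * F y c) / (1 - \<nu> x (x i))\<bar> \<le> B i"
    proof -
      let ?S = "\<Sum>c\<in>{1..q} - {x i}. \<nu> x c * (F x c - F y c)"
      have "\<bar>?S\<bar> \<le> (\<Sum>c\<in>{1..q} - {x i}. \<nu> x c * B i)"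
      proof (rule order.trans[OF sum_abs], rule sum_mono)
        fix c assume "c \<in> {1..q} - {x i}"
        then have "\<bar>F x c - F y c\<bar> \<le> B i" using F_xy by blast
        then show "\<bar>\<nu> x c * (F x c - F y c)\<bar> \<le> \<nu> x c * B i"
          unfolding abs_mult abs_of_nonneg[OF nu_nn] by (rule mult_left_mono[OF _ nu_nn])
      qed
      also have "\<dots> = (1 - \<nu> x (x i)) * B i"
        using xi nu_one unfolding sum_distrib_right[symmetric] by (subst sum_diff1) auto
      finally have "\<bar>?S / (1 - \<nu> x (x i))\<bar> \<le> B i"
        using nu_less[of "x i"] by (simp add: abs_divide pos_divide_le_eq mult.commute)
      then show ?thesis by (simp add: right_diff_distrib sum_subtractf diff_divide_distrib)
    qed
    have second: "\<bar>(\<Sum>c\<in>{1..q} - {x i}. \<nu> x c * F y c) / (1 - \<nu> x (x i))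
        - (\<Sum>c\<in>{1..q} - {y i}. \<nu> x c * F y c) / (1 - \<nu> x (y i))\<bar> \<le> s * B j"
    proof (cases "\<nu> x (y i) \<le> \<nu> x (x i)")
      case True
      show ?thesis
        by (rule conditional_mean_diff[OF _ nu_nn nu_one xi yi s0 nu_le nu_less True F_cc]) auto
    next
      case False
      then show ?thesis
        by (subst abs_minus_commute)
          (rule conditional_mean_diff[OF _ nu_nn nu_one yi xi s0 nu_le nu_less _ F_cc], auto)
    qed
    have "\<bar>mean (updates V E q \<Theta> x) f - mean (updates V E q \<Theta> y) f\<bar> \<le> B i + s * B j"
      using first second unfolding split[OF x] split[OF y] nu_eq[symmetric] by linarith
    also have "s * B j = (\<Sum>p\<in>simple_paths E \<Theta>' j. s ^ length (j # p) * d (last (i # j # p)))"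
      unfolding B_def sum_distrib_left by (intro sum.cong) (auto simp: mult.assoc)
    also have "\<dots> = (\<Sum>p\<in>(#) j ` simple_paths E \<Theta>' j. s ^ length p * d (last (i # p)))"
      by (subst sum.reindex) (auto simp: inj_on_def)
    also have "B i + \<dots> = (\<Sum>p\<in>simple_paths E \<Theta>' i \<union> (#) j ` simple_paths E \<Theta>' j.
        s ^ length p * d (last (i # p)))"
      unfolding B_def
    proof (rule sum.union_disjoint[symmetric])
      have "finite \<Theta>'" using finT by (simp add: \<Theta>'_def)
      then show "finite (simple_paths E \<Theta>' i)" "finite ((#) j ` simple_paths E \<Theta>' j)"
        by (auto intro: finite_simple_paths)
    qed (auto simp: \<Theta>'_def simple_paths_def)
    also have "\<dots> \<le> (\<Sum>p\<in>simple_paths E \<Theta> i. s ^ length p * d (last (i # p)))"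
    proof (rule sum_mono2[OF finP])
      show "simple_paths E \<Theta>' i \<union> (#) j ` simple_paths E \<Theta>' j \<subseteq> simple_paths E \<Theta> i"
        using simple_paths_mono[of E E \<Theta>' \<Theta> i] Cons_in_simple_paths[OF ij jT iT]
        by (auto simp: \<Theta>'_def)
    qed (use s0 d in auto)
    finally show ?thesis .
  qed
qed

section \<open>Rooted trees given by a parent function\<close>

text \<open>Parent pointers and levels replace paths by recursion on levels. By
  \<open>edge_cases\<close> every edge joins a site to its parent, so E is a tree.\<close>

locale parent_tree =
  fixes V :: "'a set" and E :: "'a rel" and \<rho> :: 'a and par :: "'a \<Rightarrow> 'a" and lev :: "'a \<Rightarrow> nat"
  assumes finite_V: "finite V" and E_subset: "E \<subseteq> V \<times> V" and sym_E: "sym E" and root: "\<rho> \<in> V"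
    and lev_root: "lev \<rho> = 0"
    and par_edge: "\<And>v. v \<in> V \<Longrightarrow> v \<noteq> \<rho> \<Longrightarrow> (par v, v) \<in> E"
    and lev_par: "\<And>v. v \<in> V \<Longrightarrow> v \<noteq> \<rho> \<Longrightarrow> lev v = Suc (lev (par v))"
    and edge_cases: "\<And>u v. (u, v) \<in> E \<Longrightarrow> (v \<noteq> \<rho> \<and> u = par v) \<or> (u \<noteq> \<rho> \<and> v = par u)"
begin

definition children :: "'a \<Rightarrow> 'a set" where
  "children v = {c \<in> V. c \<noteq> \<rho> \<and> par c = v}"

definition ancestors :: "'a \<Rightarrow> 'a set" where
  "ancestors v = (\<lambda>a. (par ^^ a) v) ` {..lev v}"

definition descendants :: "'a \<Rightarrow> 'a set" where
  "descendants v = {u \<in> V. v \<in> ancestors u}"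

definition block :: "nat \<Rightarrow> 'a \<Rightarrow> 'a set" where
  "block h r = {v \<in> descendants r. lev v < lev r + h}"

lemma lev_eq_0_iff: "v \<in> V \<Longrightarrow> lev v = 0 \<longleftrightarrow> v = \<rho>"
  using lev_par lev_root by (cases "v = \<rho>") auto

lemma par_in_V: "v \<in> V \<Longrightarrow> v \<noteq> \<rho> \<Longrightarrow> par v \<in> V"
  using par_edge E_subset by blast

lemma finite_children [simp]: "finite (children v)"
  using finite_V by (simp add: children_def)

lemma neighbours:
  assumes "v \<in> V"
  shows "E `` {v} = children v \<union> (if v = \<rho> then {} else {par v})"
proof (intro equalityI subsetI)
  fix u assume "u \<in> E `` {v}"
  then have "(v, u) \<in> E" "u \<in> V" using E_subset by auto
  with edge_cases show "u \<in> children v \<union> (if v = \<rho> then {} else {par v})"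
    unfolding children_def by auto
next
  fix u assume "u \<in> children v \<union> (if v = \<rho> then {} else {par v})"
  then show "u \<in> E `` {v}"
    using par_edge[of u] symD[OF sym_E par_edge[OF assms]] by (auto simp: children_def split: if_splits)
qed

lemma par_notin_children: "v \<in> V \<Longrightarrow> v \<noteq> \<rho> \<Longrightarrow> par v \<notin> children v"
  using lev_par[of v] lev_par[of "par v"] by (auto simp: children_def)

lemma funpow_par:
  assumes "v \<in> V" "a \<le> lev v"
  shows "(par ^^ a) v \<in> V \<and> lev ((par ^^ a) v) = lev v - a"
  using assms(2)
proof (induction a)
  case 0
  then show ?case using assms by simp
next
  case (Suc a)
  then have "(par ^^ a) v \<in> V" "lev ((par ^^ a) v) = lev v - a" by auto
  moreover from this Suc.prems have "(par ^^ a) v \<noteq> \<rho>" using lev_root by auto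
  ultimately show ?case using lev_par[of "(par ^^ a) v"] par_in_V[of "(par ^^ a) v"] by auto
qed

lemma self_in_ancestors [simp]: "v \<in> ancestors v"
  unfolding ancestors_def by (rule image_eqI[of _ _ 0]) auto

lemma ancestors_par:
  assumes "v \<in> V" "v \<noteq> \<rho>"
  shows "ancestors v = insert v (ancestors (par v))"
  unfolding ancestors_def lev_par[OF assms] atMost_Suc_eq_insert_0 image_insert image_image funpow_Suc_right comp_apply
  by simp

lemma ancestors_root: "ancestors \<rho> = {\<rho>}"
  by (simp add: ancestors_def lev_root)

lemma ancestor_lev: "v \<in> V \<Longrightarrow> u \<in> ancestors v \<Longrightarrow> u \<in> V \<and> lev u \<le> lev v"
  unfolding ancestors_def using funpow_par by auto

lemma ancestor_eqI: "v \<in> V \<Longrightarrow> u \<in> ancestors v \<Longrightarrow> w \<in> ancestors v \<Longrightarrow> lev u = lev w \<Longrightarrow> u = w"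
  unfolding ancestors_def using funpow_par[of v] by clarify (metis atMost_iff diff_diff_cancel)

lemma descendants_subset: "descendants v \<subseteq> V" by (auto simp: descendants_def)

lemma finite_descendants [simp]: "finite (descendants v)"
  using descendants_subset finite_V finite_subset by blast

lemma child_in_descendants: "v \<in> descendants r \<Longrightarrow> c \<in> children v \<Longrightarrow> c \<in> descendants r"
  unfolding descendants_def children_def using ancestors_par by auto

lemma lev_child: "c \<in> children v \<Longrightarrow> lev c = Suc (lev v)"
  unfolding children_def using lev_par by auto

lemma descendants_children:
  assumes v: "v \<in> V"
  shows "insert v (\<Union>c\<in>children v. descendants c) \<subseteq> descendants v"
proof -
  have "v \<in> ancestors u" if "u \<in> V" "c \<in> children v" "c \<in> ancestors u" for u c
    using that
  proof (induction "lev u" arbitrary: u)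
    case 0
    then show ?case using lev_eq_0_iff by (auto simp: ancestors_root children_def)
  next
    case (Suc k)
    then have u: "u \<noteq> \<rho>" using lev_root by auto
    show ?case
    proof (cases "u = c")
      case True
      then show ?thesis using Suc u by (auto simp: children_def ancestors_par)
    next
      case False
      then have "c \<in> ancestors (par u)" using Suc.prems u ancestors_par by auto
      then show ?thesis
        using Suc.hyps(1)[of "par u"] Suc.hyps(2) Suc.prems u lev_par par_in_V ancestors_par by auto
    qed
  qed
  then show ?thesis using v by (auto simp: descendants_def)
qed

section \<open>Subtree sizes and site weights\<close>

definition subtree_size :: "'a \<Rightarrow> real" where
  "subtree_size v = real (card (descendants v))"

lemma subtree_size_children:
  assumes v: "v \<in> V"
  shows "1 + (\<Sum>c\<in>children v. subtree_size c) \<le> subtree_size v"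
proof -
  have disj: "descendants c \<inter> descendants c' = {}"
    if "c \<in> children v" "c' \<in> children v" "c \<noteq> c'" for c c'
  proof -
    have "c = c'" if "u \<in> V" "c \<in> ancestors u" "c' \<in> ancestors u" for u
      using ancestor_eqI[OF that] lev_child \<open>c \<in> children v\<close> \<open>c' \<in> children v\<close> by simp
    then show ?thesis using that by (auto simp: descendants_def)
  qed
  have "v \<notin> descendants c" if "c \<in> children v" for c
    using that lev_child ancestor_lev[OF v, of c] unfolding descendants_def by auto
  then have "card (insert v (\<Union>c\<in>children v. descendants c)) = Suc (\<Sum>c\<in>children v. card (descendants c))"
    using disj by (subst card_insert_disjoint) (auto intro!: card_UN_disjoint)
  moreover have "card (insert v (\<Union>c\<in>children v. descendants c)) \<le> card (descendants v)"
    by (rule card_mono[OF finite_descendants descendants_children[OF v]])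
  ultimately have "Suc (\<Sum>c\<in>children v. card (descendants c)) \<le> card (descendants v)" by simp
  then have "real (Suc (\<Sum>c\<in>children v. card (descendants c))) \<le> real (card (descendants v))"
    by (simp only: of_nat_le_iff)
  then show ?thesis by (simp add: subtree_size_def)
qed

lemma subtree_size_ge_1: "v \<in> V \<Longrightarrow> 1 \<le> subtree_size v"
  using subtree_size_children[of v] sum_nonneg[of "children v" subtree_size] by (auto simp: subtree_size_def)

lemma subtree_size_le_card: "subtree_size v \<le> real (card V)"
  unfolding subtree_size_def by (simp add: card_mono[OF finite_V descendants_subset])

lemma subtree_size_par:
  assumes "v \<in> V" "v \<noteq> \<rho>"
  shows "subtree_size v \<le> subtree_size (par v)"
proof -
  have "v \<in> children (par v)" using assms by (simp add: children_def)
  then have "subtree_size v \<le> (\<Sum>c\<in>children (par v). subtree_size c)"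
    by (intro member_le_sum) (auto simp: subtree_size_def)
  then show ?thesis using subtree_size_children[OF par_in_V[OF assms]] by linarith
qed

text \<open>Summed over all sites \<open>i\<close>, this is \<open>\<xi>\<close> to the power of the distance of \<open>v\<close> from the path between
  \<open>i\<close> and the root. The weight \<open>\<xi> ^ lev v\<close> would not do, since it can be exponentially small in the
  number of sites.\<close>

definition weight :: "real \<Rightarrow> 'a \<Rightarrow> real" where
  "weight \<xi> v = (\<Sum>a<lev v. \<xi> ^ a * ((1 - \<xi>) * subtree_size ((par ^^ a) v))) + \<xi> ^ lev v * subtree_size \<rho>"

lemma weight_root: "weight \<xi> \<rho> = subtree_size \<rho>"
  by (simp add: weight_def lev_root)

text \<open>From the parent to v, the sites i below v keep contributing 1 while every other site is
  one edge further off: W v = n v + \<xi> * (W (par v) - n v).\<close>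

lemma weight_par:
  assumes "v \<in> V" "v \<noteq> \<rho>"
  shows "weight \<xi> v = \<xi> * weight \<xi> (par v) + (1 - \<xi>) * subtree_size v"
  unfolding weight_def lev_par[OF assms] sum.lessThan_Suc_shift funpow_Suc_right comp_apply
  by (simp add: distrib_left sum_distrib_left mult.assoc)

text \<open>\<open>weight_par\<close> is a convex combination of the parent's weight and the subtree
  size of v. Both bounds therefore propagate from the root, the lower one because subtree sizes grow
  towards the root.\<close>

lemma weight_bounds:
  assumes "0 \<le> \<xi>" "\<xi> \<le> 1" "v \<in> V"
  shows "subtree_size v \<le> weight \<xi> v \<and> weight \<xi> v \<le> real (card V)"
  using assms(3)
proof (induction "lev v" arbitrary: v)
  case 0
  then show ?case using lev_eq_0_iff weight_root subtree_size_le_card by auto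
next
  case (Suc k)
  then have v: "v \<noteq> \<rho>" using lev_root by auto
  have IH: "subtree_size (par v) \<le> weight \<xi> (par v)" "weight \<xi> (par v) \<le> real (card V)"
    using Suc.hyps(1)[of "par v"] Suc.hyps(2) Suc.prems v lev_par par_in_V by auto
  have "\<xi> * subtree_size v + (1 - \<xi>) * subtree_size v \<le> weight \<xi> v"
    unfolding weight_par[OF Suc.prems v] using IH(1) subtree_size_par[OF Suc.prems v] assms
    by (intro add_mono mult_left_mono) auto
  moreover have "weight \<xi> v \<le> \<xi> * real (card V) + (1 - \<xi>) * real (card V)"
    unfolding weight_par[OF Suc.prems v] using IH(2) assms
    by (intro add_mono mult_left_mono subtree_size_le_card) auto
  ultimately show ?case by (simp add: algebra_simps)
qed

end

section \<open>Total influence on a site of a block\<close>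

text \<open>Influence paths read backwards: simple paths from v that stop at the first site outside
  \<Theta>. X is meant for the site just left, so that a path cannot turn back.\<close>

definition exits :: "'a set \<Rightarrow> 'a rel \<Rightarrow> 'a set \<Rightarrow> 'a set \<Rightarrow> 'a \<Rightarrow> 'a list set" where
  "exits V E \<Theta> X v = {q. q \<noteq> [] \<and> hd q = v \<and> distinct q \<and> set q \<subseteq> V - X \<and>
     successively (\<lambda>u v. (u, v) \<in> E) q \<and> set (butlast q) \<subseteq> \<Theta> \<and> last q \<notin> \<Theta>}"

definition exit_weight :: "'a set \<Rightarrow> 'a rel \<Rightarrow> 'a set \<Rightarrow> real \<Rightarrow> ('a \<Rightarrow> real) \<Rightarrow> 'a set \<Rightarrow> 'a \<Rightarrow> real" where
  "exit_weight V E \<Theta> s w X v = (\<Sum>q\<in>exits V E \<Theta> X v. s ^ (length q - 1) * w (last q))"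

lemma finite_exits: "finite V \<Longrightarrow> finite (exits V E \<Theta> X v)"
  by (rule finite_subset[OF _ finite_subset_distinct[of V]]) (auto simp: exits_def)

lemma exit_weight_outside:
  assumes "v \<notin> \<Theta>" "0 \<le> w v"
  shows "exit_weight V E \<Theta> s w X v \<le> w v"
proof -
  have "q = [v]" if "q \<in> exits V E \<Theta> X v" for q
    using that assms(1) by (cases q) (auto simp: exits_def split: if_splits)
  then have "exits V E \<Theta> X v \<subseteq> {[v]}" by blast
  then consider "exits V E \<Theta> X v = {}" | "exits V E \<Theta> X v = {[v]}" by blast
  then show ?thesis unfolding exit_weight_def using assms(2) by cases auto
qed

text \<open>After the step to z only v stays blocked. That gives an upper bound in general and loses
  nothing in a tree, where a path can get back behind v only through v.\<close>

lemma exit_weight_step: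
  assumes fin: "finite V" and EV: "E \<subseteq> V \<times> V" and v: "v \<in> \<Theta>" and s: "0 \<le> s" and w: "\<And>v. v \<in> V \<Longrightarrow> 0 \<le> w v"
  shows "exit_weight V E \<Theta> s w X v \<le> s * (\<Sum>z\<in>E `` {v} - X. exit_weight V E \<Theta> s w {v} z)"
proof -
  let ?g = "\<lambda>q. s ^ (length q - 1) * w (last q)"
  have finN: "finite (E `` {v} - X)" by (rule finite_subset[OF _ fin]) (use EV in auto)
  have sub: "exits V E \<Theta> X v \<subseteq> (\<Union>z\<in>E `` {v} - X. (#) v ` exits V E \<Theta> {v} z)"
  proof
    fix q assume q: "q \<in> exits V E \<Theta> X v"
    then obtain q' where q': "q = v # q'" by (cases q) (auto simp: exits_def)
    have "q' \<noteq> []" using q v by (auto simp: q' exits_def)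
    then obtain z q'' where z: "q' = z # q''" by (cases q') auto
    have "q' \<in> exits V E \<Theta> {v} z" "z \<in> E `` {v} - X" using q by (auto simp: q' z exits_def)
    then show "q \<in> (\<Union>z\<in>E `` {v} - X. (#) v ` exits V E \<Theta> {v} z)" using q' by blast
  qed
  have "exit_weight V E \<Theta> s w X v \<le> sum ?g (\<Union>z\<in>E `` {v} - X. (#) v ` exits V E \<Theta> {v} z)"
    unfolding exit_weight_def
  proof (rule sum_mono2[OF _ sub])
    fix q assume "q \<in> (\<Union>z\<in>E `` {v} - X. (#) v ` exits V E \<Theta> {v} z) - exits V E \<Theta> X v"
    then obtain z q' where q: "q = v # q'" "q' \<in> exits V E \<Theta> {v} z" by auto
    then have "q' \<noteq> []" "set q' \<subseteq> V" by (auto simp: exits_def)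
    then have "last q' \<in> V" using last_in_set by blast
    then show "0 \<le> ?g q" using q s w \<open>q' \<noteq> []\<close> by simp
  qed (simp add: finN finite_exits[OF fin])
  also have "\<dots> = (\<Sum>z\<in>E `` {v} - X. sum ?g ((#) v ` exits V E \<Theta> {v} z))"
  proof (rule sum.UNION_disjoint[OF finN])
    show "\<forall>z\<in>E `` {v} - X. finite ((#) v ` exits V E \<Theta> {v} z)" by (simp add: finite_exits[OF fin])
    show "\<forall>z\<in>E `` {v} - X. \<forall>z'\<in>E `` {v} - X. z \<noteq> z' \<longrightarrow>
        (#) v ` exits V E \<Theta> {v} z \<inter> (#) v ` exits V E \<Theta> {v} z' = {}"
      by (auto simp: exits_def)
  qed
  also have "\<dots> = (\<Sum>z\<in>E `` {v} - X. s * exit_weight V E \<Theta> s w {v} z)"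
  proof (rule sum.cong[OF refl])
    fix z
    have "sum ?g ((#) v ` exits V E \<Theta> {v} z) = (\<Sum>q\<in>exits V E \<Theta> {v} z. s ^ length q * w (last (v # q)))"
      by (subst sum.reindex) (auto simp: inj_on_def)
    also have "\<dots> = (\<Sum>q\<in>exits V E \<Theta> {v} z. s * ?g q)"
      by (rule sum.cong[OF refl]) (auto simp: exits_def neq_Nil_conv)
    finally show "sum ?g ((#) v ` exits V E \<Theta> {v} z) = s * exit_weight V E \<Theta> s w {v} z"
      by (simp add: exit_weight_def sum_distrib_left)
  qed
  finally show ?thesis by (simp add: sum_distrib_left)
qed

text \<open>Exchange of summation: reversing a path from a boundary site i to j in the block gives
  an exit from j. The empty path is left out, since it is the oscillation that i keeps and not one
  that it receives.\<close>

lemma sum_simple_paths_le_exit_weight: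
  assumes fin: "finite V" and EV: "E \<subseteq> V \<times> V" and symE: "sym E" and TV: "\<Theta> \<subseteq> V" and s: "0 \<le> s"
    and w: "\<And>v. v \<in> V \<Longrightarrow> 0 \<le> w v" and d: "\<And>v. 0 \<le> d v"
  shows "(\<Sum>i\<in>V - \<Theta>. w i * (\<Sum>p\<in>simple_paths E \<Theta> i - {[]}. s ^ length p * d (last (i # p))))
    \<le> (\<Sum>j\<in>\<Theta>. d j * exit_weight V E \<Theta> s w {} j)"
proof -
  let ?g = "\<lambda>q. d (hd q) * (s ^ (length q - 1) * w (last q))"
  define P where "P = (SIGMA i:V - \<Theta>. simple_paths E \<Theta> i - {[]})"
  have finT: "finite \<Theta>" using TV fin finite_subset by blast
  have "(\<Sum>i\<in>V - \<Theta>. w i * (\<Sum>p\<in>simple_paths E \<Theta> i - {[]}. s ^ length p * d (last (i # p))))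
    = (\<Sum>(i, p)\<in>P. w i * (s ^ length p * d (last (i # p))))"
    unfolding P_def sum_distrib_left using fin finT by (subst sum.Sigma) (auto intro: finite_simple_paths)
  also have "\<dots> = (\<Sum>x\<in>P. ?g (rev (fst x # snd x)))"
    by (rule sum.cong) (auto simp: P_def hd_rev split: prod.splits)
  also have "\<dots> = sum ?g ((\<lambda>x. rev (fst x # snd x)) ` P)"
    by (subst sum.reindex) (auto simp: inj_on_def simp del: rev.simps)
  also have "\<dots> \<le> sum ?g (\<Union>j\<in>\<Theta>. exits V E \<Theta> {} j)"
  proof (rule sum_mono2)
    show "finite (\<Union>j\<in>\<Theta>. exits V E \<Theta> {} j)" by (simp add: finT finite_exits[OF fin])
    show "(\<lambda>x. rev (fst x # snd x)) ` P \<subseteq> (\<Union>j\<in>\<Theta>. exits V E \<Theta> {} j)"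
    proof clarify
      fix i p assume "(i, p) \<in> P"
      then have i: "i \<in> V" "i \<notin> \<Theta>" and p: "distinct (i # p)" "set p \<subseteq> \<Theta>" "p \<noteq> []"
        "successively (\<lambda>u v. (u, v) \<in> E) (i # p)"
        by (auto simp: P_def simple_paths_def)
      have "successively (\<lambda>u v. (u, v) \<in> E) (rev (i # p))"
        unfolding successively_rev using p(4)
        by (rule successively_mono) (use symD[OF symE] in auto)
      then have "rev (i # p) \<in> exits V E \<Theta> {} (last p)"
        using i p TV by (auto simp: exits_def hd_append hd_rev)
      moreover have "last p \<in> \<Theta>" using p by auto
      ultimately show "rev (fst (i, p) # snd (i, p)) \<in> (\<Union>j\<in>\<Theta>. exits V E \<Theta> {} j)" by auto
    qed
    fix q assume "q \<in> (\<Union>j\<in>\<Theta>. exits V E \<Theta> {} j) - (\<lambda>x. rev (fst x # snd x)) ` P"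
    then have "q \<noteq> []" "set q \<subseteq> V" by (auto simp: exits_def)
    then have "last q \<in> V" using last_in_set by blast
    then show "0 \<le> ?g q" using s w d by simp
  qed
  also have "\<dots> = (\<Sum>j\<in>\<Theta>. sum ?g (exits V E \<Theta> {} j))"
  proof (rule sum.UNION_disjoint[OF finT])
    show "\<forall>j\<in>\<Theta>. finite (exits V E \<Theta> {} j)" by (simp add: finite_exits[OF fin])
    show "\<forall>j\<in>\<Theta>. \<forall>j'\<in>\<Theta>. j \<noteq> j' \<longrightarrow> exits V E \<Theta> {} j \<inter> exits V E \<Theta> {} j' = {}"
      by (auto simp: exits_def)
  qed
  also have "\<dots> = (\<Sum>j\<in>\<Theta>. d j * exit_weight V E \<Theta> s w {} j)"
    unfolding exit_weight_def sum_distrib_left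
    by (intro sum.cong refl) (auto simp: exits_def)
  finally show ?thesis .
qed

text \<open>Exit weights are bounded linearly in the weight \<open>W\<close> and the subtree size \<open>n\<close> of a site.
  Levels of a block run from \<open>1\<close> (the top) to \<open>h\<close>, so the sites just outside have level \<open>0\<close> or
  \<open>h + 1\<close>. A site of level \<open>m\<close> entered from above contributes at most
  \<open>on m * n + off m * (W - n)\<close>, and one of level \<open>l\<close> entered from a child with subtree size \<open>n'\<close> at
  most \<open>A l * n' + M l * (W - n')\<close>.\<close>

locale influence_certificate =
  fixes b h :: nat and s \<xi> \<alpha> :: real and on off A M :: "nat \<Rightarrow> real"
  assumes s_nonneg: "0 \<le> s" and xi: "0 < \<xi>" "\<xi> \<le> 1" and b_pos: "1 \<le> b" and alpha_nonneg: "0 \<le> \<alpha>"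
    and off_nonneg: "\<And>m. m \<in> {1..Suc h} \<Longrightarrow> 0 \<le> off m"
    and off_le_on: "\<And>m. m \<in> {1..Suc h} \<Longrightarrow> \<xi> * off m \<le> on m"
    and off_le_1: "\<And>m. m \<in> {1..Suc h} \<Longrightarrow> \<xi> * off m \<le> 1"
    and bottom: "1 \<le> on (Suc h)" "1 \<le> off (Suc h)"
    and on_step: "\<And>m. m \<in> {1..h} \<Longrightarrow> s * (on (Suc m) + (real b - 1) * \<xi> * off (Suc m)) \<le> on m"
    and off_step: "\<And>m. m \<in> {1..h} \<Longrightarrow> s * (real b * \<xi> * off (Suc m)) \<le> off m"
    and top: "1 \<le> A 0" "1 \<le> M 0"
    and A_step: "\<And>l. l \<in> {1..<h} \<Longrightarrow> s * (A (l - 1) + (real b - 1) * \<xi> * off (Suc l)) \<le> A l"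
    and M_step_on: "\<And>l. l \<in> {1..<h} \<Longrightarrow>
      s * (A (l - 1) + (real b - 1) * \<xi> * off (Suc l) + (on (Suc l) - \<xi> * off (Suc l))) \<le> M l"
    and M_step_off: "\<And>l. l \<in> {1..<h} \<Longrightarrow> s * (M (l - 1) / \<xi> + (real b - 1) * \<xi> * off (Suc l)) \<le> M l"
    and on_total: "\<And>l. l \<in> {1..h} \<Longrightarrow> s * (A (l - 1) + (on (Suc l) + (real b - 1) * \<xi> * off (Suc l))) \<le> \<alpha>"
    and off_total: "\<And>l. l \<in> {1..h} \<Longrightarrow> s * (M (l - 1) / \<xi> + real b * \<xi> * off (Suc l)) \<le> \<alpha>"

text \<open>The root has no parent, so a degree bound of b + 1 allows it one child more. In the
  estimates this child takes the place of the parent.\<close>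

locale certified_tree = parent_tree V E \<rho> par lev + influence_certificate b h s \<xi> \<alpha> on off A M
  for V :: "'a set" and E \<rho> par lev b h s \<xi> \<alpha> on off A M +
  assumes card_children: "\<And>v. v \<in> V \<Longrightarrow> v \<noteq> \<rho> \<Longrightarrow> card (children v) \<le> b"
    and card_children_root: "card (children \<rho>) \<le> Suc b"
begin

abbreviation W :: "'a \<Rightarrow> real" where "W \<equiv> weight \<xi>"
abbreviation n :: "'a \<Rightarrow> real" where "n \<equiv> subtree_size"

lemma size_le_weight: "v \<in> V \<Longrightarrow> n v \<le> W v"
  using weight_bounds[of \<xi> v] xi by auto

lemma weight_ge_1: "v \<in> V \<Longrightarrow> 1 \<le> W v"
  using size_le_weight subtree_size_ge_1 order_trans by blast

lemma weight_nonneg: "v \<in> V \<Longrightarrow> 0 \<le> W v"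
  using weight_ge_1 order_trans zero_le_one by blast

text \<open>The reason for this choice of weights: the share of the sites not below c scales by
  exactly \<xi> between v and its child c.\<close>

lemma weight_minus_size:
  assumes "v \<in> V" "c \<in> children v"
  shows "W c - n c = \<xi> * (W v - n c)"
  using weight_par[of c \<xi>] assms by (simp add: children_def algebra_simps)

text \<open>Every child is charged \<xi> * off m relative to v, and children on the path the surplus
  on m - \<xi> * off m in addition. The surplus is nonnegative by \<open>off_le_on\<close>, so upper
  bounds N and k suffice.\<close>

lemma sum_children_le:
  assumes v: "v \<in> V" and C: "C \<subseteq> children v" "real (card C) \<le> k" "sum n C \<le> N" and m: "m \<in> {1..Suc h}"
  shows "(\<Sum>c\<in>C. on m * n c + off m * (W c - n c)) \<le> (on m - \<xi> * off m) * N + k * \<xi> * off m * W v"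
proof -
  have "(\<Sum>c\<in>C. on m * n c + off m * (W c - n c)) = (\<Sum>c\<in>C. (on m - \<xi> * off m) * n c + \<xi> * off m * W v)"
  proof (rule sum.cong[OF refl])
    fix c assume "c \<in> C"
    then have eq: "W c - n c = \<xi> * (W v - n c)" using weight_minus_size[OF v] C by blast
    show "on m * n c + off m * (W c - n c) = (on m - \<xi> * off m) * n c + \<xi> * off m * W v"
      unfolding eq by (simp add: algebra_simps)
  qed
  also have "\<dots> = (on m - \<xi> * off m) * sum n C + real (card C) * (\<xi> * off m * W v)"
    by (simp add: sum.distrib sum_distrib_left)
  also have "\<dots> \<le> (on m - \<xi> * off m) * N + k * (\<xi> * off m * W v)"
    using C off_le_on[OF m] off_nonneg[OF m] xi weight_nonneg[OF v]
    by (intro add_mono mult_left_mono mult_right_mono) auto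
  finally show ?thesis by (simp add: mult.assoc)
qed

context
  fixes r :: 'a and \<Theta> :: "'a set"
  assumes r: "r \<in> V" and \<Theta>: "\<Theta> = block h r"
begin

text \<open>\<open>S {u} v\<close> is the exit weight at v when it is entered from the neighbour
  u.\<close>

definition S :: "'a set \<Rightarrow> 'a \<Rightarrow> real" where "S X v = exit_weight V E \<Theta> s W X v"

lemma in_block_iff: "v \<in> descendants r \<Longrightarrow> v \<in> \<Theta> \<longleftrightarrow> lev v < lev r + h"
  by (auto simp: \<Theta> block_def)

lemma S_step: "v \<in> \<Theta> \<Longrightarrow> S X v \<le> s * (\<Sum>z\<in>E `` {v} - X. S {v} z)"
  unfolding S_def by (rule exit_weight_step[OF finite_V E_subset _ s_nonneg weight_nonneg])

lemma S_outside: "v \<in> V \<Longrightarrow> v \<notin> \<Theta> \<Longrightarrow> S X v \<le> W v"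
  unfolding S_def by (rule exit_weight_outside) (auto simp: weight_nonneg)

lemma desc_lev: "v \<in> descendants r \<Longrightarrow> v \<in> V \<and> lev r \<le> lev v"
  unfolding descendants_def using ancestor_lev by auto

text \<open>Induction from the bottom upwards: a site entered from its parent passes on to its
  children only. \<open>Suc (lev v) - lev r\<close> is the level in the block, with r on level 1,
  and v \<noteq> r excludes the root of the tree.\<close>

lemma S_down:
  assumes "v \<in> descendants r" "v \<noteq> r" "lev v \<le> lev r + h"
  shows "S {par v} v \<le> on (Suc (lev v) - lev r) * n v + off (Suc (lev v) - lev r) * (W v - n v)"
  using assms
proof (induction "lev r + h - lev v" arbitrary: v)
  case 0
  then have v: "v \<in> V" and eq: "lev v = lev r + h" using desc_lev by auto
  have "v \<notin> \<Theta>" using in_block_iff[OF 0(2)] eq by simp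
  then have "S {par v} v \<le> 1 * n v + 1 * (W v - n v)" using S_outside[OF v] by simp
  also have "\<dots> \<le> on (Suc h) * n v + off (Suc h) * (W v - n v)"
    using bottom size_le_weight[OF v] subtree_size_ge_1[OF v]
    by (intro add_mono mult_right_mono) auto
  finally show ?case using eq by simp
next
  case (Suc k)
  then have v: "v \<in> V" and less: "lev v < lev r + h" and ge: "lev r \<le> lev v" using desc_lev by auto
  define m where "m = Suc (lev v) - lev r"
  have m: "m \<in> {1..h}" "Suc m \<in> {1..Suc h}" using less ge by (auto simp: m_def)
  have root: "v \<noteq> \<rho>"
    using Suc.prems ancestors_root by (auto simp: descendants_def)
  have "S {par v} v \<le> s * (\<Sum>z\<in>E `` {v} - {par v}. S {v} z)"
    by (rule S_step) (use in_block_iff Suc.prems less in auto)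
  also have "E `` {v} - {par v} = children v"
    using neighbours[OF v] root par_notin_children[OF v] by auto
  also have "(\<Sum>z\<in>children v. S {v} z) \<le> (\<Sum>c\<in>children v. on (Suc m) * n c + off (Suc m) * (W c - n c))"
  proof (rule sum_mono)
    fix c assume c: "c \<in> children v"
    have "par c = v" using c by (simp add: children_def)
    moreover have "c \<noteq> r" using lev_child[OF c] ge by auto
    ultimately show "S {v} c \<le> on (Suc m) * n c + off (Suc m) * (W c - n c)"
      using Suc.hyps(1)[of c] Suc.hyps(2) lev_child[OF c] child_in_descendants[OF Suc.prems(1) c] less ge
      by (simp add: m_def Suc_diff_le)
  qed
  also have "\<dots> \<le> (on (Suc m) - \<xi> * off (Suc m)) * n v + real b * \<xi> * off (Suc m) * W v"
    by (rule sum_children_le[OF v order_refl])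
      (use card_children[OF v root] subtree_size_children[OF v] m in auto)
  also have "\<dots> = (on (Suc m) + (real b - 1) * \<xi> * off (Suc m)) * n v + real b * \<xi> * off (Suc m) * (W v - n v)"
    by (simp add: algebra_simps)
  also have "s * \<dots> = s * (on (Suc m) + (real b - 1) * \<xi> * off (Suc m)) * n v
      + s * (real b * \<xi> * off (Suc m)) * (W v - n v)"
    by (simp add: algebra_simps)
  also have "\<dots> \<le> on m * n v + off m * (W v - n v)"
    using on_step[OF m(1)] off_step[OF m(1)] size_le_weight[OF v] subtree_size_ge_1[OF v]
    by (intro add_mono mult_right_mono) auto
  finally show ?case using s_nonneg by (simp add: m_def mult_left_mono)
qed

lemma S_children_le:
  assumes v: "v \<in> \<Theta>" and C: "C \<subseteq> children v" "real (card C) \<le> k" "sum n C \<le> N"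
  defines "m \<equiv> Suc (Suc (lev v) - lev r)"
  shows "(\<Sum>c\<in>C. S {v} c) \<le> (on m - \<xi> * off m) * N + k * \<xi> * off m * W v"
proof -
  have vd: "v \<in> descendants r" and less: "lev v < lev r + h" using v by (auto simp: \<Theta> block_def)
  have vV: "v \<in> V" and ge: "lev r \<le> lev v" using desc_lev[OF vd] by auto
  have "(\<Sum>c\<in>C. S {v} c) \<le> (\<Sum>c\<in>C. on m * n c + off m * (W c - n c))"
  proof (rule sum_mono)
    fix c assume "c \<in> C"
    then have c: "c \<in> children v" using C by blast
    have "par c = v" using c by (simp add: children_def)
    moreover have "c \<noteq> r" using lev_child[OF c] ge by auto
    ultimately show "S {v} c \<le> on m * n c + off m * (W c - n c)"
      using S_down[of c] lev_child[OF c] child_in_descendants[OF vd c] less ge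
      by (simp add: m_def Suc_diff_le)
  qed
  also have "\<dots> \<le> (on m - \<xi> * off m) * N + k * \<xi> * off m * W v"
    by (rule sum_children_le[OF vV C]) (use less ge in \<open>auto simp: m_def\<close>)
  finally show ?thesis .
qed

text \<open>Induction from the top downwards: a site entered from c passes on to its parent, which
  is the same situation one level higher, and to its other children, which \<open>S_down\<close>
  covers. Level l = 0 is the parent of r, just outside the block.\<close>

lemma S_up:
  assumes "c \<in> children v" "v \<in> V" "l < h"
    and "(l = 0 \<and> r \<noteq> \<rho> \<and> v = par r) \<or> (0 < l \<and> v \<in> descendants r \<and> Suc (lev v) = lev r + l)"
  shows "S {c} v \<le> A l * n c + M l * (W v - n c)"
  using assms
proof (induction l arbitrary: c v)
  case 0
  then have v: "v = par r" "r \<noteq> \<rho>" by auto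
  have "lev v < lev r" using lev_par[OF r] v by simp
  then have "v \<notin> \<Theta>" using desc_lev[of v] by (auto simp: \<Theta> block_def)
  then have "S {c} v \<le> 1 * n c + 1 * (W v - n c)"
    using S_outside[OF 0(2)] by simp
  also have "\<dots> \<le> A 0 * n c + M 0 * (W v - n c)"
    using top size_le_weight[OF 0(2)] subtree_size_par[of c] 0(1) subtree_size_ge_1[of c]
    by (intro add_mono mult_right_mono) (auto simp: children_def)
  finally show ?case .
next
  case (Suc l)
  note c = Suc.prems(1) and v = Suc.prems(2)
  have vd: "v \<in> descendants r" and lev: "lev v = lev r + l" using Suc.prems(4) by auto
  have vT: "v \<in> \<Theta>" using in_block_iff[OF vd] lev Suc.prems(3) by simp
  let ?on = "on (Suc (Suc l))" and ?off = "off (Suc (Suc l))"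
  have m: "Suc (Suc l) \<in> {1..Suc h}" "Suc l \<in> {1..<h}" using Suc.prems(3) by auto
  have cV: "c \<in> V" "c \<noteq> \<rho>" "par c = v" using c by (auto simp: children_def)
  have nc: "n c \<le> n v" "1 \<le> n c" using subtree_size_par[of c] subtree_size_ge_1[of c] cV by auto
  let ?D = "(?on - \<xi> * ?off) * (n v - n c) + (real b - 1) * \<xi> * ?off * W v"
  have sum_n: "sum n (children v - {c}) \<le> n v - n c"
    using subtree_size_children[OF v] c by (simp add: sum_diff1)
  have card_C: "real (card (children v - {c})) = real (card (children v)) - 1"
    using c by (simp add: of_nat_diff card_gt_0_iff Suc_leI) (metis One_nat_def Suc_leI card_gt_0_iff empty_iff finite_children of_nat_1 of_nat_diff)
  have main: "(\<Sum>z\<in>E `` {v} - {c}. S {v} z)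
      \<le> A l * n v + M l * ((W v - n v) / \<xi>) + ?D"
  \<comment> \<open>At the root up to b children besides c may remain. Since \<xi> * off \<le> 1
    \<le> A 0 there, the extra child is covered by the term reserved for the missing parent.\<close>
  proof (cases "v = \<rho>")
    case True
    have "v = r" using vd True ancestors_root by (auto simp: descendants_def)
    then have l: "l = 0" using lev by simp
    have "E `` {v} - {c} = children v - {c}" using neighbours[OF v] True by auto
    then have "(\<Sum>z\<in>E `` {v} - {c}. S {v} z) \<le> (?on - \<xi> * ?off) * (n v - n c) + real b * \<xi> * ?off * W v"
      using S_children_le[OF vT, of "children v - {c}" "real b" "n v - n c"] card_C card_children_root sum_n
        True lev by (simp add: Suc_diff_le)
    also have "\<dots> = ?D + \<xi> * ?off * W v" by (simp add: algebra_simps)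
    also have "\<xi> * ?off * W v \<le> A l * W v"
      using off_le_1[OF m(1)] top l weight_nonneg[OF v] by (intro mult_right_mono) auto
    also have "W v = n v" using True weight_root by simp
    finally show ?thesis by (simp add: True weight_root)
  next
    case False
    have pV: "par v \<in> V" and vc: "v \<in> children (par v)" using par_in_V[OF v False] v False by (auto simp: children_def)
    have "E `` {v} - {c} = insert (par v) (children v - {c})"
      using neighbours[OF v] False par_notin_children[OF v False] c by auto
    then have "(\<Sum>z\<in>E `` {v} - {c}. S {v} z) = S {v} (par v) + (\<Sum>z\<in>children v - {c}. S {v} z)"
      using par_notin_children[OF v False] by simp
    also have "(\<Sum>z\<in>children v - {c}. S {v} z) \<le> ?D"
      using S_children_le[OF vT, of "children v - {c}" "real b - 1" "n v - n c"] card_C card_children[OF v False] sum_n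
        lev by (simp add: Suc_diff_le)
    also have "S {v} (par v) \<le> A l * n v + M l * (W (par v) - n v)"
    proof (rule Suc.IH[OF vc pV])
      show "l < h" using Suc.prems by simp
      show "(l = 0 \<and> r \<noteq> \<rho> \<and> par v = par r) \<or> (0 < l \<and> par v \<in> descendants r \<and> Suc (lev (par v)) = lev r + l)"
      proof (cases "v = r")
        case True
        then show ?thesis using False lev by simp
      next
        case ne: False
        then have "par v \<in> descendants r"
          using vd ancestors_par[OF v False] pV by (auto simp: descendants_def)
        then show ?thesis using lev_par[OF v False] lev desc_lev by fastforce
      qed
    qed
    also have "\<dots> = A l * n v + M l * ((W v - n v) / \<xi>)"
      unfolding weight_minus_size[OF pV vc] using xi by simp
    finally show ?thesis by simp
  qed
  have "S {c} v \<le> s * (\<Sum>z\<in>E `` {v} - {c}. S {v} z)" by (rule S_step[OF vT])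
  also have "\<dots> \<le> s * (A l * n v + M l * ((W v - n v) / \<xi>) + ?D)"
    by (rule mult_left_mono[OF main s_nonneg])
  \<comment> \<open>The weight of v is split into the shares of the sites below c, of those below v
    but not below c, and of those not below v. The certificate has one inequality for each
    share.\<close>
  also have "\<dots> = s * (A l + (real b - 1) * \<xi> * ?off) * n c
      + s * (A l + (real b - 1) * \<xi> * ?off + (?on - \<xi> * ?off)) * (n v - n c)
      + s * (M l / \<xi> + (real b - 1) * \<xi> * ?off) * (W v - n v)"
    using xi by (simp add: field_simps)
  also have "\<dots> \<le> A (Suc l) * n c + M (Suc l) * (n v - n c) + M (Suc l) * (W v - n v)"
    using A_step[OF m(2)] M_step_on[OF m(2)] M_step_off[OF m(2)] nc size_le_weight[OF v]
    by (intro add_mono mult_right_mono) auto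
  finally show ?case by (simp add: algebra_simps)
qed

text \<open>Both recursions meet at v: \<open>S_up\<close> bounds what leaves through the parent,
  \<open>S_children_le\<close> what leaves through the children.\<close>

lemma S_total:
  assumes v: "v \<in> \<Theta>"
  shows "S {} v \<le> \<alpha> * W v"
proof -
  have vd: "v \<in> descendants r" and less: "lev v < lev r + h" using v by (auto simp: \<Theta> block_def)
  have vV: "v \<in> V" and ge: "lev r \<le> lev v" using desc_lev[OF vd] by auto
  obtain l where lev: "lev v = lev r + l" using ge le_Suc_ex by blast
  let ?on = "on (Suc (Suc l))" and ?off = "off (Suc (Suc l))"
  have m: "Suc (Suc l) \<in> {1..Suc h}" "Suc l \<in> {1..h}" using less lev by auto
  let ?D = "(?on - \<xi> * ?off) * n v + real b * \<xi> * ?off * W v"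
  have sum_n: "sum n (children v) \<le> n v" using subtree_size_children[OF vV] by simp
  have main: "(\<Sum>z\<in>E `` {v}. S {v} z) \<le> A l * n v + M l * ((W v - n v) / \<xi>) + ?D"
  proof (cases "v = \<rho>")
    case True
    have "v = r" using vd True ancestors_root by (auto simp: descendants_def)
    then have l: "l = 0" using lev by simp
    have "E `` {v} = children v" using neighbours[OF vV] True by auto
    then have "(\<Sum>z\<in>E `` {v}. S {v} z) \<le> (?on - \<xi> * ?off) * n v + (real b + 1) * \<xi> * ?off * W v"
      using S_children_le[OF v, of "children v" "real b + 1" "n v"] card_children_root sum_n
        True lev by (simp add: Suc_diff_le)
    also have "\<dots> = ?D + \<xi> * ?off * W v" by (simp add: algebra_simps)
    also have "\<xi> * ?off * W v \<le> A l * W v"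
      using off_le_1[OF m(1)] top l weight_nonneg[OF vV] by (intro mult_right_mono) auto
    also have "W v = n v" using True weight_root by simp
    finally show ?thesis by (simp add: True weight_root)
  next
    case False
    have pV: "par v \<in> V" and vc: "v \<in> children (par v)" using par_in_V[OF vV False] vV False by (auto simp: children_def)
    have "E `` {v} = insert (par v) (children v)" using neighbours[OF vV] False by auto
    then have "(\<Sum>z\<in>E `` {v}. S {v} z) = S {v} (par v) + (\<Sum>z\<in>children v. S {v} z)"
      using par_notin_children[OF vV False] by simp
    also have "(\<Sum>z\<in>children v. S {v} z) \<le> ?D"
      using S_children_le[OF v, of "children v" "real b" "n v"] card_children[OF vV False] sum_n
        lev by (simp add: Suc_diff_le)
    also have "S {v} (par v) \<le> A l * n v + M l * (W (par v) - n v)"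
    proof (rule S_up[OF vc pV])
      show "l < h" using less lev by simp
      show "(l = 0 \<and> r \<noteq> \<rho> \<and> par v = par r) \<or> (0 < l \<and> par v \<in> descendants r \<and> Suc (lev (par v)) = lev r + l)"
      proof (cases "v = r")
        case True
        then show ?thesis using False lev by simp
      next
        case ne: False
        then have "par v \<in> descendants r"
          using vd ancestors_par[OF vV False] pV by (auto simp: descendants_def)
        then show ?thesis using lev_par[OF vV False] lev desc_lev by fastforce
      qed
    qed
    also have "\<dots> = A l * n v + M l * ((W v - n v) / \<xi>)"
      unfolding weight_minus_size[OF pV vc] using xi by simp
    finally show ?thesis by simp
  qed
  have "S {} v \<le> s * (\<Sum>z\<in>E `` {v} - {}. S {v} z)" by (rule S_step[OF v])
  also have "\<dots> \<le> s * (A l * n v + M l * ((W v - n v) / \<xi>) + ?D)"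
    using mult_left_mono[OF main s_nonneg] by simp
  also have "\<dots> = s * (A l + (?on + (real b - 1) * \<xi> * ?off)) * n v
      + s * (M l / \<xi> + real b * \<xi> * ?off) * (W v - n v)"
    using xi by (simp add: field_simps)
  also have "\<dots> \<le> \<alpha> * n v + \<alpha> * (W v - n v)"
    using on_total[OF m(2)] off_total[OF m(2)] subtree_size_ge_1[OF vV] size_le_weight[OF vV]
    by (intro add_mono mult_right_mono) auto
  finally show ?thesis by (simp add: algebra_simps)
qed

end

theorem exit_weight_block_le:
  assumes "r \<in> V" "v \<in> block h r"
  shows "exit_weight V E (block h r) s W {} v \<le> \<alpha> * W v"
  using S_total[OF assms(1) refl assms(2)] by (simp add: S_def[OF assms(1) refl])

end

section \<open>The parent function of a rooted tree\<close>

locale rooted_undirected_tree =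
  fixes G :: "'a pair_pre_digraph" and \<rho> :: 'a
  assumes tree: "undirected_tree G" and root: "\<rho> \<in> pverts G"
begin

sublocale pair_graph G using tree by (simp add: undirected_tree_def)

lemma no_long_cycle: "cycle p \<Longrightarrow> length p < 3"
  using tree unfolding undirected_tree_def by (meson not_le)

text \<open>Any other path, closed up by the reversed edge, would be a cycle of length at least
  3.\<close>

lemma apath_edge:
  assumes uv: "(u, v) \<in> parcs G" and p: "apath u p v"
  shows "p = [(u, v)]"
proof -
  have ne: "p \<noteq> []" using p no_loops'[OF uv] by (auto simp: apath_Nil_iff)
  have vu: "(v, u) \<in> parcs G" using arcs_symmetric[OF uv] .
  have p': "awalk u p v" "distinct (pawalk_verts u p)" using p by (auto simp: apath_def)
  have "awalk v ((v, u) # p) v" using p' vu by (auto simp: awalk_Cons_iff)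
  then have "cycle ((v, u) # p)" using p' by (auto simp: cycle_def intro!: exI[of _ v])
  from no_long_cycle[OF this] ne obtain e where "p = [e]" by (cases p) auto
  then show ?thesis using p' by (cases e) (auto simp: awalk_simps)
qed

lemma apath_last_edge:
  assumes p: "apath w p v" and uv: "(u, v) \<in> parcs G" and u: "u \<in> set (pawalk_verts w p)"
  obtains p' where "p = p' @ [(u, v)]" "apath w p' u"
proof -
  have "awalk w p v" using p by (simp add: apath_def)
  from awalk_decomp[OF this u] obtain q r where qr: "p = q @ r" "awalk w q u" "awalk u r v" by blast
  then have "apath w q u" "apath u r v" using p by (auto simp: apath_append_iff)
  with apath_edge[OF uv] that qr show ?thesis by blast
qed

lemma pawalk_verts_snoc: "pcas w p (fst e) \<Longrightarrow> pawalk_verts w (p @ [e]) = pawalk_verts w p @ [snd e]"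
  by (induction p arbitrary: w) auto

lemma awalk_snoc_iff: "awalk w (p @ [e]) v \<longleftrightarrow> awalk w p (fst e) \<and> e \<in> parcs G \<and> snd e = v"
proof
  assume "awalk w (p @ [e]) v"
  then show "awalk w p (fst e) \<and> e \<in> parcs G \<and> snd e = v"
    by (auto simp: awalk_simps)
next
  assume *: "awalk w p (fst e) \<and> e \<in> parcs G \<and> snd e = v"
  then have "awalk (fst e) [e] v" using arc_snd_in_verts by (auto simp: awalk_simps)
  then show "awalk w (p @ [e]) v" using * awalk_appendI by blast
qed

lemma apath_snoc_iff:
  "apath w (p @ [e]) v \<longleftrightarrow>
    apath w p (fst e) \<and> e \<in> parcs G \<and> snd e = v \<and> v \<notin> set (pawalk_verts w p)"
proof (cases "awalk w p (fst e)")
  case True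
  then have "pcas w p (fst e)" by blast
  then show ?thesis using True unfolding apath_def awalk_snoc_iff by (auto simp: pawalk_verts_snoc)
next
  case False
  then show ?thesis unfolding apath_def awalk_snoc_iff by simp
qed

text \<open>Going back along one path and forward along the other, both without their last edges,
  joins the tails of these edges while avoiding v. Adding the last edge of p' gives a path from fst
  e to v, which \<open>apath_edge\<close> reduces to a single edge, so the tails agree.\<close>

lemma apath_unique: "apath w p v \<Longrightarrow> apath w p' v \<Longrightarrow> p = p'"
proof (induction p arbitrary: v p' rule: rev_induct)
  case Nil
  then have "w = v" by (simp add: apath_Nil_iff)
  then show ?case using Nil by (cases p') (auto simp: apath_nonempty_ends)
next
  case (snoc e p)
  then have e: "e \<in> parcs G" "snd e = v" "apath w p (fst e)" "v \<notin> set (pawalk_verts w p)"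
    by (auto simp: apath_snoc_iff)
  show ?case
  proof (cases p' rule: rev_cases)
    case Nil
    then have "w = v" using snoc.prems by (simp add: apath_Nil_iff)
    then show ?thesis using snoc.prems by (auto simp: apath_nonempty_ends)
  next
    case (snoc q f)
    then have f: "f \<in> parcs G" "snd f = v" "apath w q (fst f)" "v \<notin> set (pawalk_verts w q)"
      using snoc.prems by (auto simp: apath_snoc_iff)
    define t where "t = rev_path p @ q"
    have walk: "awalk (fst e) t (fst f)" unfolding t_def
      using e f by (auto simp: apath_def)
    have "fst a \<noteq> v \<and> snd a \<noteq> v" if "a \<in> set t" for a
    proof -
      have "set (rev_path p) = prod.swap ` set p" by (induction p) auto
      then have "a \<in> prod.swap ` set p \<or> a \<in> set q" using that by (auto simp: t_def)
      moreover have "set (pawalk_verts w p) = {w} \<union> set (map fst p) \<union> set (map snd p)"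
        "set (pawalk_verts w q) = {w} \<union> set (map fst q) \<union> set (map snd q)"
        using e(3) f(3) set_awalk_verts[of w p "fst e"] set_awalk_verts[of w q "fst f"]
        by (simp_all add: apath_def)
      ultimately show ?thesis using e(4) f(4) by (cases a) (force simp: image_iff)
    qed
    then have avoid: "fst a \<noteq> v \<and> snd a \<noteq> v" if "a \<in> set (awalk_to_apath t)" for a
      using awalk_to_apath_subset[OF walk] that by blast
    have ap: "apath (fst e) (awalk_to_apath t) (fst f)" by (rule apath_awalk_to_apath[OF walk])
    have ev: "(fst e, v) \<in> parcs G" and fv: "(fst f, v) \<in> parcs G"
      using e(1,2) f(1,2) by (cases e, cases f, simp)+
    have "set (pawalk_verts (fst e) (awalk_to_apath t))
        = {fst e} \<union> set (map fst (awalk_to_apath t)) \<union> set (map snd (awalk_to_apath t))"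
      using ap set_awalk_verts[of "fst e" "awalk_to_apath t" "fst f"] by (simp add: apath_def)
    then have "v \<notin> set (pawalk_verts (fst e) (awalk_to_apath t))"
      using avoid no_loops'[OF ev] by auto
    then have "apath (fst e) (awalk_to_apath t @ [(fst f, v)]) v" using ap fv by (simp add: apath_snoc_iff)
    from apath_edge[OF ev this] have "fst e = fst f" by simp
    moreover have "p = q" by (rule snoc.IH[OF e(3)]) (use f(3) \<open>fst e = fst f\<close> in simp)
    ultimately show ?thesis using e(2) f(2) \<open>p' = q @ [f]\<close> by (simp add: prod_eq_iff)
  qed
qed

definition root_path :: "'a \<Rightarrow> ('a \<times> 'a) list" where
  "root_path v = (THE p. apath \<rho> p v)"

definition par :: "'a \<Rightarrow> 'a" where "par v = fst (last (root_path v))"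

definition lev :: "'a \<Rightarrow> nat" where "lev v = length (root_path v)"

lemma root_path_eqI: "apath \<rho> p v \<Longrightarrow> root_path v = p"
  unfolding root_path_def by (rule the_equality) (auto intro: apath_unique)

lemma apath_root_path:
  assumes "v \<in> pverts G"
  shows "apath \<rho> (root_path v) v"
proof -
  have "strongly_connected (mk_symmetric (with_proj G))"
    using tree by (simp add: undirected_tree_def connected_def)
  then have "\<rho> \<rightarrow>\<^sup>*\<^bsub>mk_symmetric (with_proj G)\<^esub> v"
    using root assms by (auto simp: strongly_connected_def)
  then have "\<rho> \<rightarrow>\<^sup>*\<^bsub>with_proj G\<^esub> v"
    using reachable_mk_symmetric_eq[OF sym_arcs] by simp
  then obtain p where "apath \<rho> p v" using reachable_apath by blast
  then show ?thesis using root_path_eqI by simp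
qed

lemma root_path_root: "root_path \<rho> = []"
  by (rule root_path_eqI) (simp add: apath_Nil_iff root)

lemma root_path_par:
  assumes "v \<in> pverts G" "v \<noteq> \<rho>"
  shows "root_path v = root_path (par v) @ [(par v, v)]" "(par v, v) \<in> parcs G"
proof -
  have ap: "apath \<rho> (root_path v) v" by (rule apath_root_path[OF assms(1)])
  then obtain p e where p: "root_path v = p @ [e]"
    using assms(2) by (cases "root_path v" rule: rev_cases) (auto simp: apath_Nil_iff)
  then have e: "e \<in> parcs G" "snd e = v" "apath \<rho> p (fst e)"
    using ap by (auto simp: apath_snoc_iff)
  have "par v = fst e" by (simp add: par_def p)
  with e show "root_path v = root_path (par v) @ [(par v, v)]" "(par v, v) \<in> parcs G"
    using root_path_eqI[OF e(3)] p by (cases e, simp)+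
qed

sublocale parent_tree "pverts G" "parcs G" \<rho> par lev
proof
  show "sym (parcs G)" using arcs_symmetric by (auto intro: symI)
  show "parcs G \<subseteq> pverts G \<times> pverts G" using in_arcsD1 in_arcsD2 by auto
  show "lev \<rho> = 0" by (simp add: lev_def root_path_root)
  show "(par v, v) \<in> parcs G" "lev v = Suc (lev (par v))" if "v \<in> pverts G" "v \<noteq> \<rho>" for v
    using root_path_par[OF that] by (auto simp: lev_def)
  show "(v \<noteq> \<rho> \<and> u = par v) \<or> (u \<noteq> \<rho> \<and> v = par u)" if uv: "(u, v) \<in> parcs G" for u v
  proof -
    have v: "apath \<rho> (root_path v) v" by (rule apath_root_path[OF in_arcsD2[OF uv]])
    show ?thesis
    \<comment> \<open>If the root path of v visits u, it must end with the edge from u to v. If not,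
      appending (v, u) to it gives the root path of u.\<close>
    proof (cases "u \<in> set (pawalk_verts \<rho> (root_path v))")
      case True
      from apath_last_edge[OF v uv True] obtain p where "root_path v = p @ [(u, v)]" by blast
      then have "par v = u" "v \<noteq> \<rho>" using root_path_root by (auto simp: par_def)
      then show ?thesis by simp
    next
      case False
      have "root_path u = root_path v @ [(v, u)]"
        using v arcs_symmetric[OF uv] False by (intro root_path_eqI) (simp add: apath_snoc_iff)
      then have "par u = v" "u \<noteq> \<rho>" using root_path_root by (auto simp: par_def)
      then show ?thesis by simp
    qed
  qed
qed (use root pair_finite_verts in auto)

lemma root_path_verts:
  assumes "v \<in> pverts G"
  shows "set (pawalk_verts \<rho> (root_path v)) = ancestors v"
  using assms
proof (induction "lev v" arbitrary: v)
  case 0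
  then have "v = \<rho>" using lev_eq_0_iff by auto
  then show ?case by (simp add: ancestors_root root_path_root)
next
  case (Suc k)
  then have v: "v \<noteq> \<rho>" using lev_root by auto
  have pV: "par v \<in> pverts G" using par_in_V Suc.prems v by blast
  have "pcas \<rho> (root_path (par v)) (par v)" using apath_root_path[OF pV] by (auto simp: apath_def)
  then show ?case
    using Suc.hyps(1)[of "par v"] Suc.hyps(2) lev_par[OF Suc.prems v] pV
    unfolding root_path_par(1)[OF Suc.prems v] ancestors_par[OF Suc.prems v]
    by (simp add: pawalk_verts_snoc)
qed

lemma below_iff:
  assumes "v \<in> pverts G"
  shows "below G \<rho> r v \<longleftrightarrow> r \<in> ancestors v"
proof -
  have "apath \<rho> p v \<longleftrightarrow> p = root_path v" for p
    using root_path_eqI[of p v] apath_root_path[OF assms] by blast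
  then show ?thesis by (simp add: below_def root_path_verts[OF assms, symmetric] awalk_verts_with_proj_eq)
qed

text \<open>An edge raises the level by at most one. This is the lower bound in
  \<open>edge_dist_ancestor\<close>.\<close>

lemma awalk_lev: "awalk u p v \<Longrightarrow> lev v \<le> lev u + length p"
proof (induction p arbitrary: u)
  case Nil
  then show ?case by (simp add: awalk_Nil_iff)
next
  case (Cons e p)
  then have e: "(u, snd e) \<in> parcs G" and "awalk (snd e) p v"
    by (cases e, auto simp: awalk_Cons_iff)+
  then have "lev v \<le> lev (snd e) + length p" using Cons.IH by blast
  moreover have "lev (snd e) \<le> Suc (lev u)"
    using edge_cases[OF e] lev_par[OF in_arcsD1[OF e]] lev_par[OF in_arcsD2[OF e]] by auto
  ultimately show ?case by simp
qed

lemma exists_awalk_from_ancestor: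
  assumes "v \<in> pverts G" "r \<in> ancestors v"
  shows "\<exists>p. awalk r p v \<and> length p = lev v - lev r"
  using assms
proof (induction "lev v" arbitrary: v)
  case 0
  then have "v = \<rho>" using lev_eq_0_iff by auto
  then show ?case using 0 by (intro exI[of _ "[]"]) (simp add: ancestors_root awalk_Nil_iff root)
next
  case (Suc k)
  show ?case
  proof (cases "r = v")
    case True
    then show ?thesis using Suc.prems by (intro exI[of _ "[]"]) (simp add: awalk_Nil_iff)
  next
    case False
    have v: "v \<noteq> \<rho>" using Suc lev_root by auto
    have pV: "par v \<in> pverts G" using par_in_V Suc.prems v by blast
    have r: "r \<in> ancestors (par v)" using False Suc.prems ancestors_par[OF _ v] by auto
    then obtain p where p: "awalk r p (par v)" "length p = lev (par v) - lev r"
      using Suc.hyps(1)[of "par v"] Suc.hyps(2) lev_par[OF Suc.prems(1) v] pV by auto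
    have "awalk (par v) [(par v, v)] v"
      using par_edge[OF Suc.prems(1) v] by (simp add: awalk_simps in_arcsD2)
    with p(1) have "awalk r (p @ [(par v, v)]) v" by (rule awalk_appendI)
    moreover have "length (p @ [(par v, v)]) = lev v - lev r"
      using p(2) lev_par[OF Suc.prems(1) v] ancestor_lev[OF pV r] by (simp add: Suc_diff_le)
    ultimately show ?thesis by blast
  qed
qed

lemma edge_dist_ancestor:
  assumes "v \<in> pverts G" "r \<in> ancestors v"
  shows "edge_dist G r v = lev v - lev r"
  unfolding edge_dist_def
proof (rule Least_equality)
  show "\<exists>p. awalk r p v \<and> length p = lev v - lev r"
    by (rule exists_awalk_from_ancestor[OF assms])
qed (use awalk_lev in force)

lemma subtree_block_eq:
  assumes "1 \<le> h"
  shows "subtree_block G \<rho> h r = block h r"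
  using assms ancestor_lev
  by (fastforce simp: subtree_block_def block_def descendants_def below_iff edge_dist_ancestor)

lemma card_neighbours_le: "card (parcs G `` {v}) \<le> max_degree G"
proof (cases "v \<in> pverts G")
  case True
  have "parcs G `` {v} = snd ` out_arcs G v" by (force simp: image_iff)
  then have "card (parcs G `` {v}) \<le> out_degree G v"
    using card_image_le[OF finite_out_arcs, of snd v] by (simp add: out_degree_def)
  also have "\<dots> \<le> max_degree G"
    unfolding max_degree_def using True pair_finite_verts by (intro Max_ge) auto
  finally show ?thesis .
next
  case False
  then have "parcs G `` {v} = {}" using in_arcsD1 by auto
  then show ?thesis by simp
qed

lemma card_children_le:
  assumes "v \<in> pverts G"
  shows "card (children v) + (if v = \<rho> then 0 else 1) \<le> max_degree G"
  using card_neighbours_le[of v] par_notin_children[OF assms]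
  unfolding neighbours[OF assms] by (auto split: if_splits)

lemma awalk_of_vertices:
  assumes "successively (\<lambda>u v. (u, v) \<in> parcs G) (i # p)" "i \<in> pverts G"
  shows "awalk i (zip (i # p) p) (last (i # p)) \<and> pawalk_verts i (zip (i # p) p) = i # p"
  using assms
proof (induction p arbitrary: i)
  case Nil
  then show ?case by (simp add: awalk_Nil_iff)
next
  case (Cons j p)
  then show ?case using in_arcsD2 by (auto simp: awalk_Cons_iff)
qed

lemma edge_is_only_path: "edge_is_only_path (parcs G)"
  unfolding edge_is_only_path_def
proof (intro allI impI)
  fix i j p assume ij: "(i, j) \<in> parcs G" and p: "p \<in> simple_paths (parcs G) UNIV i" "last (i # p) = j"
  then have "apath i (zip (i # p) p) j"
    using awalk_of_vertices[of i p] in_arcsD1[OF ij] by (auto simp: apath_def simple_paths_def)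
  from apath_edge[OF ij this] show "p = [j]" by (cases p; cases "tl p") auto
qed

end

section \<open>Contraction of oscillations under a systematic scan\<close>

text \<open>The transition matrix as an operator on functions. The last factor of a product reaches
  f first, so a scan is analysed from its last block backwards.\<close>

definition act :: "('s \<Rightarrow> 's pmf) \<Rightarrow> ('s \<Rightarrow> real) \<Rightarrow> 's \<Rightarrow> real" where
  "act P f x = measure_pmf.expectation (P x) f"

lemma act_return [simp]: "act return_pmf f = f"
  by (simp add: act_def fun_eq_iff)

lemma act_kernel_mult:
  assumes "finite C" "set_pmf (P x) \<subseteq> C" "\<And>y. y \<in> C \<Longrightarrow> set_pmf (Q y) \<subseteq> C"
  shows "act (kernel_mult P Q) f x = act P (act Q f) x"
proof -
  have "act (kernel_mult P Q) f x = (\<Sum>y\<in>C. pmf (P x) y *\<^sub>R act Q f y)"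
    unfolding act_def kernel_mult_def
    by (rule pmf_expectation_bind) (use assms in \<open>auto intro: finite_subset[of _ C]\<close>)
  also have "\<dots> = act P (act Q f) x"
    unfolding act_def[of P] by (rule integral_measure_pmf[OF assms(1), symmetric]) (use assms in auto)
  finally show ?thesis .
qed

lemma kernel_prod_simps [simp]:
  "kernel_prod [] = return_pmf" "kernel_prod (P # Ps) = kernel_mult P (kernel_prod Ps)"
  by (simp_all add: kernel_prod_def)

lemma set_pmf_kernel_mult: "set_pmf (kernel_mult P Q x) = (\<Union>y\<in>set_pmf (P x). set_pmf (Q y))"
  by (simp add: kernel_mult_def)

lemma set_pmf_kernel_prod:
  assumes "\<And>P x. P \<in> set Ps \<Longrightarrow> x \<in> C \<Longrightarrow> set_pmf (P x) \<subseteq> C" "x \<in> C"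
  shows "set_pmf (kernel_prod Ps x) \<subseteq> C"
  using assms
proof (induction Ps arbitrary: x)
  case (Cons P Ps)
  then show ?case by (fastforce simp: set_pmf_kernel_mult)
qed auto

lemma act_kernel_prod_Cons:
  assumes "finite C" "\<And>P x. P \<in> set (Q # Ps) \<Longrightarrow> x \<in> C \<Longrightarrow> set_pmf (P x) \<subseteq> C" "x \<in> C"
  shows "act (kernel_prod (Q # Ps)) f x = act Q (act (kernel_prod Ps) f) x"
  using assms set_pmf_kernel_prod[of Ps C] by (auto intro!: act_kernel_mult[of C])

lemma kernel_prod_append: "kernel_prod (Ps @ Qs) = kernel_mult (kernel_prod Ps) (kernel_prod Qs)"
  by (induction Ps) (simp_all add: kernel_mult_def bind_return_pmf bind_assoc_pmf)

lemma act_kernel_prod_snoc: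
  assumes "finite C" "\<And>P x. P \<in> set (Ps @ [Q]) \<Longrightarrow> x \<in> C \<Longrightarrow> set_pmf (P x) \<subseteq> C" "x \<in> C"
  shows "act (kernel_prod (Ps @ [Q])) f x = act (kernel_prod Ps) (act Q f) x"
proof -
  have "kernel_prod [Q] = Q" by (simp add: kernel_mult_def bind_return_pmf')
  then show ?thesis unfolding kernel_prod_append
    using act_kernel_mult[OF assms(1), of "kernel_prod Ps" x Q f] set_pmf_kernel_prod[of Ps C x] assms
    by simp
qed

lemma oscillation_bound_cong:
  assumes "\<And>x. x \<in> V \<rightarrow>\<^sub>E {1..q} \<Longrightarrow> f x = g x"
  shows "oscillation_bound V q f d \<longleftrightarrow> oscillation_bound V q g d"
  using assms unfolding oscillation_bound_def by simp

text \<open>The sites are switched from y to x one at a time. The intermediate configurations may be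
  improper, which is why oscillations are measured on all configurations.\<close>

lemma oscillation_bound_total:
  assumes fin: "finite V" and osc: "oscillation_bound V q f d"
    and x: "x \<in> V \<rightarrow>\<^sub>E {1..q}" and y: "y \<in> V \<rightarrow>\<^sub>E {1..q}"
  shows "\<bar>f x - f y\<bar> \<le> sum d V"
proof -
  define z where "z A = (\<lambda>v. if v \<in> A then x v else y v)" for A
  have "\<bar>f (z A) - f y\<bar> \<le> sum d A" if "finite A" "A \<subseteq> V" for A
    using that
  proof (induction A rule: finite_induct)
    case empty
    then show ?case by (simp add: z_def)
  next
    case (insert v A)
    have zC: "z B \<in> V \<rightarrow>\<^sub>E {1..q}" for B using x y by (auto simp: z_def PiE_iff extensional_def)
    have "\<bar>f (z (insert v A)) - f (z A)\<bar> \<le> d v"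
      by (rule oscillation_boundD[OF osc _ zC zC]) (use insert.prems in \<open>auto simp: z_def\<close>)
    then show ?case using insert by simp
  qed
  moreover have "z V = x"
    using PiE_arb[OF x] PiE_arb[OF y] by (auto simp: z_def)
  ultimately show ?thesis using fin by auto
qed

text \<open>A block move removes the oscillation at the sites of its block and passes at most a fraction
  \<open>\<alpha>\<close> of their weighted oscillation on to other sites, so that after a scan covering all sites
  everything has been multiplied by \<open>\<alpha>\<close> at least once.\<close>

definition contracts_block ::
  "'a set \<Rightarrow> nat \<Rightarrow> ('a \<Rightarrow> real) \<Rightarrow> real \<Rightarrow> 'a set \<Rightarrow> (('a \<Rightarrow> nat) \<Rightarrow> ('a \<Rightarrow> nat) pmf) \<Rightarrow> bool" where
  "contracts_block V q w \<alpha> \<Theta> P \<longleftrightarrow>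
     (\<forall>f d. oscillation_bound V q f d \<longrightarrow> (\<forall>v. 0 \<le> d v) \<longrightarrow>
       (\<exists>e. (\<forall>v. 0 \<le> e v) \<and> oscillation_bound V q (act P f) (\<lambda>v. if v \<in> \<Theta> then 0 else d v + e v) \<and>
         (\<Sum>v\<in>V - \<Theta>. w v * e v) \<le> \<alpha> * (\<Sum>v\<in>\<Theta>. w v * d v)))"

text \<open>Oscillation passed on by \<Theta> has already been reduced by \<alpha>, so for the
  remaining blocks the factor 1 is good enough for it. Oscillation outside \<Theta> keeps the factor
  that the remaining blocks give it.\<close>

lemma scan_contracts:
  fixes P :: "'a set \<Rightarrow> ('a \<Rightarrow> nat) \<Rightarrow> ('a \<Rightarrow> nat) pmf" and V :: "'a set" and q :: nat
  defines "C \<equiv> V \<rightarrow>\<^sub>E {1..q}"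
  assumes fin: "finite V" and w: "\<And>v. v \<in> V \<Longrightarrow> 0 \<le> w v" and alpha: "0 \<le> \<alpha>" "\<alpha> \<le> 1"
    and "\<And>\<Theta>. \<Theta> \<in> set \<Theta>s \<Longrightarrow> \<Theta> \<subseteq> V"
    and "\<And>\<Theta> x. \<Theta> \<in> set \<Theta>s \<Longrightarrow> x \<in> C \<Longrightarrow> set_pmf (P \<Theta> x) \<subseteq> C"
    and "\<And>\<Theta>. \<Theta> \<in> set \<Theta>s \<Longrightarrow> contracts_block V q w \<alpha> \<Theta> (P \<Theta>)"
    and "oscillation_bound V q f d" "\<And>v. 0 \<le> d v"
  shows "\<exists>d'. (\<forall>v. 0 \<le> d' v) \<and> oscillation_bound V q (act (kernel_prod (map P \<Theta>s)) f) d' \<and>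
    (\<Sum>v\<in>V. w v * d' v) \<le> (\<Sum>v\<in>V. (if v \<in> \<Union>(set \<Theta>s) then \<alpha> else 1) * (w v * d v))"
  using assms(6-)
proof (induction \<Theta>s arbitrary: f d rule: rev_induct)
  case Nil
  then show ?case by (intro exI[of _ d]) simp
next
  case (snoc \<Theta> \<Theta>s)
  have TV: "\<Theta> \<subseteq> V" using snoc.prems(1) by simp
  have finC: "finite C" unfolding C_def using fin by (simp add: finite_PiE)
  obtain e where e: "\<And>v. 0 \<le> e v"
    and osc: "oscillation_bound V q (act (P \<Theta>) f) (\<lambda>v. if v \<in> \<Theta> then 0 else d v + e v)"
    and le: "(\<Sum>v\<in>V - \<Theta>. w v * e v) \<le> \<alpha> * (\<Sum>v\<in>\<Theta>. w v * d v)"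
  proof -
    have "contracts_block V q w \<alpha> \<Theta> (P \<Theta>)" using snoc.prems(3) by simp
    then show ?thesis unfolding contracts_block_def using snoc.prems(4,5) that by meson
  qed
  define d1 where "d1 v = (if v \<in> \<Theta> then 0 else d v + e v)" for v
  have d1: "oscillation_bound V q (act (P \<Theta>) f) d1" "\<And>v. 0 \<le> d1 v"
    using osc e snoc.prems(5) by (auto simp: d1_def[abs_def])
  let ?c = "\<lambda>v. if v \<in> \<Union>(set \<Theta>s) then \<alpha> else 1"
  obtain d' where d': "\<forall>v. 0 \<le> d' v" "oscillation_bound V q (act (kernel_prod (map P \<Theta>s)) (act (P \<Theta>) f)) d'"
    "(\<Sum>v\<in>V. w v * d' v) \<le> (\<Sum>v\<in>V. ?c v * (w v * d1 v))"
    using snoc.IH[OF _ _ _ d1] snoc.prems by auto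
  have "act (kernel_prod (map P (\<Theta>s @ [\<Theta>]))) f x = act (kernel_prod (map P \<Theta>s)) (act (P \<Theta>) f) x"
    if "x \<in> C" for x
    using act_kernel_prod_snoc[OF finC, of "map P \<Theta>s" "P \<Theta>" x f] snoc.prems(2) that by auto
  with d'(2) have osc': "oscillation_bound V q (act (kernel_prod (map P (\<Theta>s @ [\<Theta>]))) f) d'"
    by (subst oscillation_bound_cong) (auto simp: C_def)
  have split: "sum g V = sum g (V - \<Theta>) + sum g \<Theta>" for g :: "'a \<Rightarrow> real"
    using sum.subset_diff[OF TV fin] .
  have "(\<Sum>v\<in>V. ?c v * (w v * d1 v)) = (\<Sum>v\<in>V - \<Theta>. ?c v * (w v * d v)) + (\<Sum>v\<in>V - \<Theta>. ?c v * (w v * e v))"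
    unfolding split by (simp add: d1_def distrib_left sum.distrib)
  also have "(\<Sum>v\<in>V - \<Theta>. ?c v * (w v * e v)) \<le> (\<Sum>v\<in>V - \<Theta>. 1 * (w v * e v))"
    using alpha w e by (intro sum_mono mult_right_mono) auto
  also have "\<dots> \<le> (\<Sum>v\<in>\<Theta>. \<alpha> * (w v * d v))"
    using le by (simp add: sum_distrib_left)
  also have "(\<Sum>v\<in>V - \<Theta>. ?c v * (w v * d v)) + \<dots>
      = (\<Sum>v\<in>V. (if v \<in> \<Union>(set (\<Theta>s @ [\<Theta>])) then \<alpha> else 1) * (w v * d v))"
    unfolding split by (intro arg_cong2[of _ _ _ _ "(+)"] sum.cong) auto
  finally show ?case using d' osc' by (intro exI[of _ d']) auto
qed

lemma power_contracts:
  fixes S :: "('a \<Rightarrow> nat) \<Rightarrow> ('a \<Rightarrow> nat) pmf" and V :: "'a set" and q :: nat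
  defines "C \<equiv> V \<rightarrow>\<^sub>E {1..q}"
  assumes fin: "finite V" and alpha: "0 \<le> \<alpha>"
    and closed: "\<And>x. x \<in> C \<Longrightarrow> set_pmf (S x) \<subseteq> C"
    and contr: "\<And>f d. oscillation_bound V q f d \<Longrightarrow> (\<And>v. 0 \<le> d v) \<Longrightarrow>
      \<exists>d'. (\<forall>v. 0 \<le> d' v) \<and> oscillation_bound V q (act S f) d' \<and> (\<Sum>v\<in>V. w v * d' v) \<le> \<alpha> * (\<Sum>v\<in>V. w v * d v)"
    and osc: "oscillation_bound V q f d" "\<And>v. 0 \<le> d v"
  shows "\<exists>d'. (\<forall>v. 0 \<le> d' v) \<and> oscillation_bound V q (act (kernel_power S t) f) d' \<and>
    (\<Sum>v\<in>V. w v * d' v) \<le> \<alpha> ^ t * (\<Sum>v\<in>V. w v * d v)"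
proof (induction t)
  case 0
  then show ?case using osc by (intro exI[of _ d]) (simp add: kernel_power_def)
next
  case (Suc t)
  have finC: "finite C" unfolding C_def using fin by (simp add: finite_PiE)
  obtain d1 where d1: "\<forall>v. 0 \<le> d1 v" "oscillation_bound V q (act (kernel_power S t) f) d1"
    "(\<Sum>v\<in>V. w v * d1 v) \<le> \<alpha> ^ t * (\<Sum>v\<in>V. w v * d v)" using Suc by blast
  then obtain d2 where d2: "\<forall>v. 0 \<le> d2 v" "oscillation_bound V q (act S (act (kernel_power S t) f)) d2"
    "(\<Sum>v\<in>V. w v * d2 v) \<le> \<alpha> * (\<Sum>v\<in>V. w v * d1 v)" using contr by blast
  have "act (kernel_power S (Suc t)) f x = act S (act (kernel_power S t) f) x" if "x \<in> C" for x
    using act_kernel_prod_Cons[OF finC, of S "replicate t S" x f] closed that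
    by (auto simp: kernel_power_def)
  with d2(2) have "oscillation_bound V q (act (kernel_power S (Suc t)) f) d2"
    by (subst oscillation_bound_cong) (auto simp: C_def)
  moreover have "(\<Sum>v\<in>V. w v * d2 v) \<le> \<alpha> ^ Suc t * (\<Sum>v\<in>V. w v * d v)"
    using d2(3) mult_left_mono[OF d1(3) alpha] by (simp add: mult.assoc)
  ultimately show ?case using d2(1) by blast
qed

section \<open>Mixing\<close>

lemma act_stationary_kernel_prod:
  assumes "finite C" "\<Omega> \<subseteq> C" "\<And>P x. P \<in> set Ps \<Longrightarrow> x \<in> C \<Longrightarrow> set_pmf (P x) \<subseteq> C"
    and "\<And>P f. P \<in> set Ps \<Longrightarrow> mean \<Omega> (act P f) = mean \<Omega> f"
  shows "mean \<Omega> (act (kernel_prod Ps) f) = mean \<Omega> f"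
  using assms
proof (induction Ps)
  case (Cons P Ps)
  have "mean \<Omega> (act (kernel_prod (P # Ps)) f) = mean \<Omega> (act P (act (kernel_prod Ps) f))"
    unfolding mean_def using Cons.prems act_kernel_prod_Cons[OF Cons.prems(1), of P Ps]
    by (intro arg_cong2[of _ _ _ _ "(/)"] sum.cong) auto
  then show ?case using Cons by auto
qed simp

text \<open>Duality: the sign of the difference is a test function with values in [-1, 1] that
  attains twice the distance. By stationarity its uniform mean is also that of
  \<open>act S f\<close>, so only the oscillation of \<open>act S f\<close> enters.\<close>

lemma tv_dist_le:
  fixes S :: "('a \<Rightarrow> nat) \<Rightarrow> ('a \<Rightarrow> nat) pmf" and V :: "'a set" and q :: nat
  defines "C \<equiv> V \<rightarrow>\<^sub>E {1..q}"
  assumes fin: "finite V" and \<Omega>: "\<Omega> \<subseteq> C" "\<Omega> \<noteq> {}" and x: "x \<in> \<Omega>"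
    and closed: "set_pmf (S x) \<subseteq> C"
    and stat: "\<And>f. mean \<Omega> (act S f) = mean \<Omega> f"
    and contr: "\<And>f. oscillation_bound V q f (\<lambda>_. 2) \<Longrightarrow> \<exists>d. oscillation_bound V q (act S f) d \<and> sum d V \<le> 2 * B"
  shows "tv_dist \<Omega> (S x) (pmf_of_set \<Omega>) \<le> B"
proof -
  have finC: "finite C" unfolding C_def using fin by (simp add: finite_PiE)
  have fin\<Omega>: "finite \<Omega>" using finite_subset[OF \<Omega>(1) finC] .
  have cardpos: "real (card \<Omega>) > 0" using fin\<Omega> \<Omega>(2) by (simp add: card_gt_0_iff)
  define f where "f y = (if y \<in> \<Omega> then sgn (pmf (S x) y - pmf (pmf_of_set \<Omega>) y) else 0)" for y
  have f1: "\<bar>f y\<bar> \<le> 1" for y by (simp add: f_def sgn_if)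
  have "\<bar>f y - f z\<bar> \<le> 2" for y z using f1[of y] f1[of z] by linarith
  then have "oscillation_bound V q f (\<lambda>_. 2)" by (simp add: oscillation_bound_def)
  then obtain d where d: "oscillation_bound V q (act S f) d" "sum d V \<le> 2 * B" using contr by blast
  have diff: "act S f x - act S f y \<le> 2 * B" if "y \<in> \<Omega>" for y
  proof -
    have "x \<in> V \<rightarrow>\<^sub>E {1..q}" "y \<in> V \<rightarrow>\<^sub>E {1..q}" using x that \<Omega>(1) unfolding C_def by blast+
    from oscillation_bound_total[OF fin d(1) this] d(2) show ?thesis by linarith
  qed
  have "(\<Sum>y\<in>\<Omega>. \<bar>pmf (S x) y - pmf (pmf_of_set \<Omega>) y\<bar>)
      = (\<Sum>y\<in>\<Omega>. f y * pmf (S x) y) - (\<Sum>y\<in>\<Omega>. f y * pmf (pmf_of_set \<Omega>) y)"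
    unfolding sum_subtractf[symmetric] right_diff_distrib[symmetric]
    by (rule sum.cong) (auto simp: f_def abs_sgn mult.commute)
  also have "(\<Sum>y\<in>\<Omega>. f y * pmf (S x) y) = (\<Sum>y\<in>C. f y * pmf (S x) y)"
    using \<Omega>(1) finC by (intro sum.mono_neutral_left) (auto simp: f_def)
  also have "\<dots> = act S f x"
    unfolding act_def by (subst integral_measure_pmf[OF finC]) (use closed in \<open>auto simp: mult.commute\<close>)
  also have "(\<Sum>y\<in>\<Omega>. f y * pmf (pmf_of_set \<Omega>) y) = mean \<Omega> f"
    using fin\<Omega> \<Omega>(2) by (simp add: mean_def sum_divide_distrib)
  also have "mean \<Omega> f = mean \<Omega> (act S f)" by (rule stat[symmetric])
  also have "act S f x - mean \<Omega> (act S f) = (\<Sum>y\<in>\<Omega>. act S f x - act S f y) / card \<Omega>"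
    using cardpos by (simp add: mean_def sum_subtractf diff_divide_distrib)
  also have "\<dots> \<le> (\<Sum>y\<in>\<Omega>. 2 * B) / card \<Omega>"
    using diff cardpos by (intro divide_right_mono sum_mono) auto
  also have "\<dots> = 2 * B" using cardpos by simp
  finally show ?thesis by (simp add: tv_dist_def)
qed

lemma mixing_time_le:
  assumes "finite \<Omega>" "\<Omega> \<noteq> {}" "0 < t" "\<And>x. x \<in> \<Omega> \<Longrightarrow> tv_dist \<Omega> (kernel_power P t x) \<pi> \<le> \<epsilon>"
  shows "mixing_time \<Omega> P \<pi> \<epsilon> \<le> enat t"
  unfolding mixing_time_def
proof (rule Max.boundedI)
  show "a \<le> enat t" if "a \<in> mixing_time_from \<Omega> P \<pi> \<epsilon> ` \<Omega>" for a
    using that assms(3,4) unfolding mixing_time_from_def by (auto intro!: Inf_lower)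
qed (use assms in auto)

text \<open>\<open>N\<^sup>2\<close> stands for n weights of at most n each. From 3 \<le> N the
  logarithm is at least 1 and absorbs the rounding up of t.\<close>

lemma scans_needed:
  fixes \<alpha> \<epsilon> N :: real
  assumes alpha: "0 < \<alpha>" "\<alpha> < 1" and N: "3 \<le> N" and eps: "0 < \<epsilon>" "\<epsilon> \<le> 1"
  shows "\<exists>t>0. \<alpha> ^ t * N\<^sup>2 \<le> \<epsilon> \<and> real t \<le> (1 + 2 / - ln \<alpha>) * ln (N / \<epsilon>)"
proof -
  define m where "m = - ln \<alpha>"
  have lam: "0 < m" using alpha by (simp add: m_def)
  define L where "L = ln (N / \<epsilon>)"
  have "3 \<le> N / \<epsilon>" using N eps by (simp add: pos_le_divide_eq)
  then have "exp 1 \<le> N / \<epsilon>" using exp_le by linarith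
  then have L: "1 \<le> L" unfolding L_def using N eps by (subst ln_ge_iff) auto
  define t where "t = nat \<lceil>2 * L / m\<rceil>"
  have pos: "0 < 2 * L / m" using L lam by simp
  then have t: "0 < t" "2 * L / m \<le> real t" "real t \<le> 1 + 2 * L / m"
    unfolding t_def by linarith+
  have "\<alpha> ^ t = exp (- (real t * m))"
    using alpha by (simp add: m_def exp_of_nat_mult)
  also have "\<dots> \<le> exp (- (2 * L))" using t(2) lam by (simp add: field_simps)
  also have "\<dots> = (\<epsilon> / N)\<^sup>2"
    using N eps by (simp add: L_def exp_minus exp_double power_divide flip: exp_of_nat_mult)
  finally have "\<alpha> ^ t * N\<^sup>2 \<le> (\<epsilon> / N)\<^sup>2 * N\<^sup>2" by (intro mult_right_mono) auto
  also have "\<dots> = \<epsilon> * \<epsilon>" using N by (simp add: power2_eq_square)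
  also have "\<dots> \<le> \<epsilon>" using eps by (simp add: mult_left_le)
  finally have "\<alpha> ^ t * N\<^sup>2 \<le> \<epsilon>" .
  moreover have "real t \<le> (1 + 2 / m) * L"
  proof -
    have "1 + 2 * L / m \<le> L + 2 * L / m" using L by simp
    also have "\<dots> = (1 + 2 / m) * L" by (simp add: algebra_simps)
    finally show ?thesis using t(3) by linarith
  qed
  ultimately show ?thesis using t(1) unfolding m_def L_def by blast
qed

section \<open>Heat-bath moves as averages over \<open>updates\<close>, and their
  stationarity\<close>

lemma act_heat_bath:
  assumes "finite V" "V = pverts G" "updates V (parcs G) q \<Theta> x \<noteq> {}"
  shows "act (heat_bath G q \<Theta>) f x = mean (updates V (parcs G) q \<Theta> x) f"
    and "set_pmf (heat_bath G q \<Theta> x) = updates V (parcs G) q \<Theta> x"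
  using assms finite_updates[OF assms(1), of "parcs G" q \<Theta> x]
  unfolding act_def heat_bath_def configurations_def updates_def mean_def
  by (simp_all add: integral_pmf_of_set)

lemma proper_colourings_eq_updates: "proper_colourings G q = updates (pverts G) (parcs G) q (pverts G) x"
  if "parcs G \<subseteq> pverts G \<times> pverts G"
  using that unfolding proper_colourings_def configurations_def updates_def by auto

text \<open>Agreement outside \<Theta> partitions \<Omega> into the classes U x, and a move replaces
  f by its average over each class.\<close>

lemma mean_heat_bath_stationary:
  assumes fin: "finite V" and EV: "E \<subseteq> V \<times> V"
    and ne: "\<And>x. x \<in> \<Omega> \<Longrightarrow> updates V E q \<Theta> x \<noteq> {}" and \<Omega>: "\<Omega> = updates V E q V x0"
  shows "mean \<Omega> (\<lambda>x. mean (updates V E q \<Theta> x) f) = mean \<Omega> f"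
proof -
  have fin\<Omega>: "finite \<Omega>" unfolding \<Omega> by (rule finite_updates[OF fin])
  define U where "U x = updates V E q \<Theta> x" for x
  have U_sub: "U x \<subseteq> \<Omega>" if x: "x \<in> \<Omega>" for x
  proof
    fix y assume y: "y \<in> U x"
    show "y \<in> \<Omega>" unfolding \<Omega>
    proof (rule updatesI)
      show "y \<in> V \<rightarrow>\<^sub>E {1..q}" by (rule updatesD(1)[OF y[unfolded U_def]])
      show "y u \<noteq> y v" if uv: "(u, v) \<in> E" for u v
      proof (cases "u \<in> \<Theta> \<or> v \<in> \<Theta>")
        case True
        then show ?thesis by (rule updatesD(3)[OF y[unfolded U_def] uv])
      next
        case False
        then have "y u = x u" "y v = x v"
          using updatesD(2)[OF y[unfolded U_def]] uv EV by auto
        moreover have "x u \<noteq> x v" using uv EV by (intro updatesD(3)[OF x[unfolded \<Omega>] uv]) auto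
        ultimately show ?thesis by simp
      qed
    qed simp
  qed
  have self: "x \<in> U x" if "x \<in> \<Omega>" for x
    unfolding U_def
  proof (rule updatesI)
    show "x \<in> V \<rightarrow>\<^sub>E {1..q}" by (rule updatesD(1)[OF that[unfolded \<Omega>]])
    show "x u \<noteq> x v" if uv: "(u, v) \<in> E" for u v
      using uv EV by (intro updatesD(3)[OF \<open>x \<in> \<Omega>\<close>[unfolded \<Omega>] uv]) auto
  qed simp
  have U_eq: "U y = U x" if "y \<in> U x" for x y
    unfolding U_def using updatesD(2)[OF that[unfolded U_def]] by (intro updates_cong) auto
  have "(\<Sum>x\<in>\<Omega>. mean (U x) f) = (\<Sum>x\<in>\<Omega>. \<Sum>y\<in>U x. f y / card (U x))"
    by (simp add: mean_def sum_divide_distrib)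
  also have "\<dots> = (\<Sum>x\<in>\<Omega>. \<Sum>y | y \<in> \<Omega> \<and> y \<in> U x. f y / card (U x))"
    by (intro sum.cong refl) (use U_sub in auto)
  also have "\<dots> = (\<Sum>y\<in>\<Omega>. \<Sum>x | x \<in> \<Omega> \<and> y \<in> U x. f y / card (U x))"
    by (rule sum.swap_restrict[OF fin\<Omega> fin\<Omega>])
  also have "\<dots> = (\<Sum>y\<in>\<Omega>. f y)"
  proof (rule sum.cong[OF refl])
    fix y assume y: "y \<in> \<Omega>"
    have eq: "{x. x \<in> \<Omega> \<and> y \<in> U x} = U y"
    proof (intro equalityI subsetI)
      fix x assume "x \<in> {x. x \<in> \<Omega> \<and> y \<in> U x}"
      then show "x \<in> U y" using U_eq[of y x] self[of x] by simp
    next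
      fix x assume x: "x \<in> U y"
      then have "U x = U y" by (rule U_eq)
      then show "x \<in> {x. x \<in> \<Omega> \<and> y \<in> U x}" using x U_sub[OF y] self[OF y] by auto
    qed
    have "(\<Sum>x | x \<in> \<Omega> \<and> y \<in> U x. f y / card (U x)) = (\<Sum>x\<in>U y. f y / card (U y))"
      unfolding eq by (intro sum.cong refl) (simp add: U_eq)
    also have "\<dots> = f y"
      using ne[OF y] finite_updates[OF fin] by (simp add: U_def)
    finally show "(\<Sum>x | x \<in> \<Omega> \<and> y \<in> U x. f y / card (U x)) = f y" .
  qed
  finally show ?thesis by (simp add: mean_def[of \<Omega>] U_def)
qed

text \<open>The s of the certificate only has to dominate 1 / (q - \<Delta>), so that a certificate
  for the smallest number of colours serves all larger q.\<close>

locale certified_colouring = rooted_undirected_tree G \<rho> +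
    certified_tree "pverts G" "parcs G" \<rho> par lev b h s \<xi> \<alpha> on off A M
  for G :: "'a pair_pre_digraph" and \<rho> b h s \<xi> \<alpha> on off A M +
  fixes q \<Delta> :: nat
  assumes deg: "max_degree G \<le> \<Delta>" and q: "\<Delta> < q" and s_ge: "1 / (real q - real \<Delta>) \<le> s"
    and h_pos: "1 \<le> h" and alpha_1: "\<alpha> \<le> 1"
begin

abbreviation "V \<equiv> pverts G"
abbreviation "E \<equiv> parcs G"
abbreviation "C \<equiv> V \<rightarrow>\<^sub>E {1..q}"

lemma degree_le: "card (E `` {v}) \<le> \<Delta>"
  using card_neighbours_le deg le_trans by blast

lemma updates_ne: "\<Theta> \<subseteq> V \<Longrightarrow> x \<in> C \<Longrightarrow> updates V E q \<Theta> x \<noteq> {}"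
  by (rule updates_nonempty[OF finite_V E_subset sym_E edge_is_only_path_irrefl[OF edge_is_only_path]
      le_less_trans[OF degree_le q]])

lemma heat_bath_contracts:
  assumes r: "r \<in> V"
  shows "contracts_block V q W \<alpha> (block h r) (heat_bath G q (block h r))"
  unfolding contracts_block_def
proof (intro allI impI)
  fix f :: "('a \<Rightarrow> nat) \<Rightarrow> real" and d :: "'a \<Rightarrow> real"
  assume osc: "oscillation_bound V q f d" and d: "\<forall>v. 0 \<le> d v"
  define \<Theta> where "\<Theta> = block h r"
  define s' where "s' = 1 / (real q - real \<Delta>)"
  have s': "0 \<le> s'" "s' \<le> s" using q s_ge by (auto simp: s'_def)
  have TV: "\<Theta> \<subseteq> V" using descendants_subset by (auto simp: \<Theta>_def block_def)
  have finT: "finite \<Theta>" using TV finite_V finite_subset by blast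
  \<comment> \<open>Of all paths from i only the nonempty ones are collected; the empty one gives
    the term d i.\<close>
  define e where "e i = (\<Sum>p\<in>simple_paths E \<Theta> i - {[]}. s ^ length p * d (last (i # p)))" for i
  have e: "0 \<le> e i" for i unfolding e_def using s_nonneg d by (intro sum_nonneg) auto
  have act: "act (heat_bath G q \<Theta>) f x = mean (updates V E q \<Theta> x) f" if "x \<in> C" for x
    by (rule act_heat_bath(1)[OF finite_V refl updates_ne[OF TV that]])
  have "oscillation_bound V q (act (heat_bath G q \<Theta>) f) (\<lambda>v. if v \<in> \<Theta> then 0 else d v + e v)"
    unfolding oscillation_bound_def
  proof (intro ballI impI)
    fix i x y assume i: "i \<in> V" and x: "x \<in> C" and y: "y \<in> C" and xy: "\<forall>u. u \<noteq> i \<longrightarrow> x u = y u"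
    show "\<bar>act (heat_bath G q \<Theta>) f x - act (heat_bath G q \<Theta>) f y\<bar> \<le> (if i \<in> \<Theta> then 0 else d i + e i)"
    proof (cases "i \<in> \<Theta>")
      case True
      then have "updates V E q \<Theta> x = updates V E q \<Theta> y"
        using xy by (intro updates_cong) auto
      then show ?thesis unfolding act[OF x] act[OF y] using True by simp
    next
      case False
      have "\<bar>mean (updates V E q \<Theta> x) f - mean (updates V E q \<Theta> y) f\<bar>
          \<le> (\<Sum>p\<in>simple_paths E \<Theta> i. s' ^ length p * d (last (i # p)))"
        using xy d by (intro mean_updates_influence[OF finite_V E_subset sym_E edge_is_only_path
          degree_le q s'_def TV i False x y _ osc]) auto
      also have "\<dots> \<le> (\<Sum>p\<in>simple_paths E \<Theta> i. s ^ length p * d (last (i # p)))"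
        using s' d by (intro sum_mono mult_right_mono power_mono) auto
      also have "\<dots> = d i + e i"
        unfolding e_def by (subst sum.remove[OF finite_simple_paths[OF finT] Nil_in_simple_paths]) simp
      finally show ?thesis unfolding act[OF x] act[OF y] using False by simp
    qed
  qed
  moreover have "(\<Sum>v\<in>V - \<Theta>. W v * e v) \<le> \<alpha> * (\<Sum>v\<in>\<Theta>. W v * d v)"
  proof -
    have "(\<Sum>v\<in>V - \<Theta>. W v * e v) \<le> (\<Sum>j\<in>\<Theta>. d j * exit_weight V E \<Theta> s W {} j)"
      unfolding e_def
      using d by (intro sum_simple_paths_le_exit_weight finite_V E_subset sym_E TV s_nonneg weight_nonneg) auto
    also have "\<dots> \<le> (\<Sum>j\<in>\<Theta>. d j * (\<alpha> * W j))"
      unfolding \<Theta>_def using d by (intro sum_mono mult_left_mono exit_weight_block_le r) auto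
    finally show ?thesis by (simp add: sum_distrib_left mult_ac)
  qed
  ultimately show "\<exists>e. (\<forall>v. 0 \<le> e v) \<and>
      oscillation_bound V q (act (heat_bath G q (block h r)) f) (\<lambda>v. if v \<in> block h r then 0 else d v + e v) \<and>
      (\<Sum>v\<in>V - block h r. W v * e v) \<le> \<alpha> * (\<Sum>v\<in>block h r. W v * d v)"
    using e unfolding \<Theta>_def by blast
qed

lemma scan_tv_dist_le:
  assumes cover: "subtree_block_cover G \<rho> h \<Theta>s" and x: "x \<in> proper_colourings G q"
  shows "tv_dist (proper_colourings G q) (kernel_power (systematic_scan G q \<Theta>s) t x)
    (pmf_of_set (proper_colourings G q)) \<le> \<alpha> ^ t * (real (card V))\<^sup>2"
proof -
  have blocks: "\<exists>r\<in>V. \<Theta> = block h r" if "\<Theta> \<in> set \<Theta>s" for \<Theta>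
    using cover that subtree_block_eq[OF h_pos] unfolding subtree_block_cover_def by auto
  have union: "\<Union>(set \<Theta>s) = V" using cover by (simp add: subtree_block_cover_def)
  have TV: "\<Theta> \<subseteq> V" if "\<Theta> \<in> set \<Theta>s" for \<Theta> using union that by blast
  define \<Omega> where "\<Omega> = proper_colourings G q"
  have \<Omega>: "\<Omega> = updates V E q V x"
    unfolding \<Omega>_def by (rule proper_colourings_eq_updates[OF E_subset])
  have \<Omega>C: "\<Omega> \<subseteq> C" by (auto simp: \<Omega>_def proper_colourings_def configurations_def)
  have finC: "finite C" using finite_V by (simp add: finite_PiE)
  have closed: "set_pmf (heat_bath G q \<Theta> y) \<subseteq> C" if "\<Theta> \<in> set \<Theta>s" "y \<in> C" for \<Theta> y
    using act_heat_bath(2)[OF finite_V refl updates_ne[OF TV[OF that(1)] that(2)]] updatesD(1) by blast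
  have closed': "set_pmf (P y) \<subseteq> C" if "P \<in> set (map (heat_bath G q) \<Theta>s)" "y \<in> C" for P y
    using that closed unfolding set_map by blast
  define S where "S = systematic_scan G q \<Theta>s"
  have S_closed: "set_pmf (S y) \<subseteq> C" if "y \<in> C" for y
    unfolding S_def systematic_scan_def by (rule set_pmf_kernel_prod[OF _ that]) (rule closed')
  have S_stat: "mean \<Omega> (act S f) = mean \<Omega> f" for f
    unfolding S_def systematic_scan_def
  proof (rule act_stationary_kernel_prod[OF finC \<Omega>C])
    show "set_pmf (P y) \<subseteq> C" if "P \<in> set (map (heat_bath G q) \<Theta>s)" "y \<in> C" for P y
      by (rule closed'[OF that])
    fix P f assume "P \<in> set (map (heat_bath G q) \<Theta>s)"
    then obtain \<Theta> where \<Theta>: "\<Theta> \<in> set \<Theta>s" "P = heat_bath G q \<Theta>" by auto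
    have ne: "updates V E q \<Theta> y \<noteq> {}" if "y \<in> \<Omega>" for y
      using updates_ne[OF TV[OF \<Theta>(1)]] \<Omega>C that by blast
    have "mean \<Omega> (act P f) = mean \<Omega> (\<lambda>y. mean (updates V E q \<Theta> y) f)"
      unfolding mean_def[of \<Omega>] \<Theta>(2)
      by (intro arg_cong2[of _ _ _ _ "(/)"] sum.cong refl act_heat_bath(1)[OF finite_V refl ne])
    also have "\<dots> = mean \<Omega> f"
      by (rule mean_heat_bath_stationary[OF finite_V E_subset ne \<Omega>])
    finally show "mean \<Omega> (act P f) = mean \<Omega> f" .
  qed
  have power_closed: "set_pmf (P y) \<subseteq> C" if "P \<in> set (replicate t S)" "y \<in> C" for P y
    using that S_closed by (metis in_set_replicate)
  have S_contr: "\<exists>d'. (\<forall>v. 0 \<le> d' v) \<and> oscillation_bound V q (act S f) d' \<and>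
      (\<Sum>v\<in>V. W v * d' v) \<le> \<alpha> * (\<Sum>v\<in>V. W v * d v)"
    if "oscillation_bound V q f d" "\<And>v. 0 \<le> d v" for f d
  proof -
    have contr: "contracts_block V q W \<alpha> \<Theta> (heat_bath G q \<Theta>)" if "\<Theta> \<in> set \<Theta>s" for \<Theta>
      using blocks[OF that] heat_bath_contracts by auto
    have "\<exists>d'. (\<forall>v. 0 \<le> d' v) \<and> oscillation_bound V q (act S f) d' \<and>
      (\<Sum>v\<in>V. W v * d' v) \<le> (\<Sum>v\<in>V. (if v \<in> \<Union>(set \<Theta>s) then \<alpha> else 1) * (W v * d v))"
      unfolding S_def systematic_scan_def
      by (rule scan_contracts[OF finite_V weight_nonneg alpha_nonneg alpha_1 TV closed contr that])
    then show ?thesis unfolding union by (simp add: sum_distrib_left)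
  qed
  show ?thesis
    unfolding \<Omega>_def[symmetric] S_def[symmetric]
  proof (rule tv_dist_le[OF finite_V \<Omega>C])
    show "\<Omega> \<noteq> {}" "x \<in> \<Omega>" using x by (auto simp: \<Omega>_def)
    show "set_pmf (kernel_power S t x) \<subseteq> C"
      unfolding kernel_power_def
      by (rule set_pmf_kernel_prod) (rule power_closed, assumption+, use x \<Omega>C \<Omega>_def in blast)
    show "mean \<Omega> (act (kernel_power S t) f) = mean \<Omega> f" for f
      unfolding kernel_power_def
      by (rule act_stationary_kernel_prod[OF finC \<Omega>C])
        (rule power_closed, assumption+, metis S_stat in_set_replicate)
    fix f assume "oscillation_bound V q f (\<lambda>_. 2)"
    then have "\<exists>d. (\<forall>v. 0 \<le> d v) \<and> oscillation_bound V q (act (kernel_power S t) f) d \<and>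
      (\<Sum>v\<in>V. W v * d v) \<le> \<alpha> ^ t * (\<Sum>v\<in>V. W v * 2)"
      by (intro power_contracts[OF finite_V alpha_nonneg S_closed S_contr]) auto
    then obtain d where d: "\<forall>v. 0 \<le> d v" "oscillation_bound V q (act (kernel_power S t) f) d"
      "(\<Sum>v\<in>V. W v * d v) \<le> \<alpha> ^ t * (\<Sum>v\<in>V. W v * 2)" by blast
    have "sum d V \<le> (\<Sum>v\<in>V. W v * d v)"
    proof (rule sum_mono)
      fix v assume "v \<in> V"
      then show "d v \<le> W v * d v" using mult_right_mono[OF weight_ge_1, of v "d v"] d(1) by simp
    qed
    also have "\<dots> \<le> \<alpha> ^ t * (\<Sum>v\<in>V. real (card V) * 2)"
      using xi weight_bounds alpha_nonneg
      by (intro order.trans[OF d(3)] mult_left_mono sum_mono mult_right_mono) auto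
    also have "\<dots> = 2 * (\<alpha> ^ t * (real (card V))\<^sup>2)"
      by (simp add: power2_eq_square)
    finally show "\<exists>d. oscillation_bound V q (act (kernel_power S t) f) d \<and>
        sum d V \<le> 2 * (\<alpha> ^ t * (real (card V))\<^sup>2)"
      using d(2) by blast
  qed
qed

lemma proper_colourings_nonempty: "proper_colourings G q \<noteq> {}"
proof -
  have "(\<lambda>v. if v \<in> V then 1 else undefined) \<in> C" using q by auto
  from updates_ne[OF order_refl this] show ?thesis using proper_colourings_eq_updates[OF E_subset] by metis
qed

end

section \<open>Numerical certificates\<close>

text \<open>The recursions for \<open>off\<close>, \<open>on\<close> and A and the inequality
  \<open>M_step_off\<close> are solved with equality. B = s * b * \<xi> is the growth factor of
  \<open>off\<close>; 1 + \<kappa>, a and c are the coefficients of B-powers forced by the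
  inhomogeneous terms. What remains as hypotheses is \<open>M_step_on\<close> and the two
  totals.\<close>

lemma closed_form_certificate:
  fixes b h :: nat and s \<xi> \<alpha> B \<kappa> \<beta> a c :: real
  assumes B_def: "B = s * real b * \<xi>" and \<kappa>_def: "\<kappa> = (1 - \<xi>) / (real b * \<xi> - 1)"
    and \<beta>_def: "\<beta> = (real b - 1) / real b"
    and a_def: "a = \<beta> / (1 - s * B)" and c_def: "c = \<beta> / (1 - real b * s\<^sup>2)"
    and s: "0 < s" and xi: "0 < \<xi>" "\<xi> \<le> 1" and b: "1 \<le> b" and bxi: "1 < real b * \<xi>"
    and B: "B \<le> 1" "s * B < 1" "real b * s\<^sup>2 < 1" and alpha: "0 \<le> \<alpha>"
    and M: "\<And>l. l \<in> {1..<h} \<Longrightarrow>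
      s ^ l + a * B ^ (Suc h - l) + \<kappa> * (B ^ (Suc h - l) - s ^ (Suc h - l)) \<le> (s / \<xi>) ^ l + c * B ^ (Suc h - l)"
    and on: "\<And>l. l \<in> {1..h} \<Longrightarrow>
      s ^ l + (s * a * B + 1 + \<kappa>) * B ^ (Suc h - l) - \<kappa> * s ^ (Suc h - l) \<le> \<alpha>"
    and off: "\<And>l. l \<in> {1..h} \<Longrightarrow> (s / \<xi>) ^ l + (real b * s\<^sup>2 * c + 1) * B ^ (Suc h - l) \<le> \<alpha>"
  shows "influence_certificate b h s \<xi> \<alpha> (\<lambda>m. (1 + \<kappa>) * B ^ (Suc h - m) - \<kappa> * s ^ (Suc h - m))
    (\<lambda>m. B ^ (Suc h - m)) (\<lambda>l. s ^ l + a * B ^ (Suc h - l)) (\<lambda>l. (s / \<xi>) ^ l + c * B ^ (Suc h - l))"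
proof -
  have kap: "0 \<le> \<kappa>" using xi bxi by (simp add: \<kappa>_def)
  have kap_eq: "\<kappa> * (real b * \<xi> - 1) = 1 - \<xi>" using bxi by (simp add: \<kappa>_def)
  have B0: "0 \<le> B" using s xi by (simp add: B_def)
  have sB: "s \<le> B" using s bxi mult_left_mono[of 1 "real b * \<xi>" s] by (simp add: B_def mult.assoc)
  have beta: "0 \<le> \<beta>" "\<beta> * B = s * ((real b - 1) * \<xi>)" using b by (auto simp: \<beta>_def B_def)
  have a: "0 \<le> a" "s * B * a + \<beta> = a" using beta B by (auto simp: a_def field_simps)
  have c: "0 \<le> c" "real b * s\<^sup>2 * c + \<beta> = c" using beta B by (auto simp: c_def field_simps)
  have sxiB: "s / \<xi> * B = real b * s\<^sup>2" using xi by (simp add: B_def power2_eq_square)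
  have B1: "B ^ j \<le> 1" for j using B0 B(1) by (simp add: power_le_one)
  have pow_le: "s ^ j \<le> B ^ j" for j using sB s by (simp add: power_mono)
  have coeff: "s * ((real b - 1) * \<xi> * B ^ j) = \<beta> * B ^ Suc j" for j
  proof -
    have "\<beta> * B ^ Suc j = (\<beta> * B) * B ^ j" by simp
    also have "\<dots> = s * ((real b - 1) * \<xi> * B ^ j)" unfolding beta(2) by (simp only: mult.assoc)
    finally show ?thesis by (rule sym)
  qed
  have onS: "s * ((1 + \<kappa>) * B ^ j - \<kappa> * s ^ j + (real b - 1) * \<xi> * B ^ j)
      = (1 + \<kappa>) * B ^ Suc j - \<kappa> * s ^ Suc j" for j
  proof -
    have "1 + \<kappa> + (real b - 1) * \<xi> = (1 + \<kappa>) * (real b * \<xi>)"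
      using kap_eq by (simp add: algebra_simps)
    then have "s * B ^ j * (1 + \<kappa> + (real b - 1) * \<xi>) = s * B ^ j * ((1 + \<kappa>) * (real b * \<xi>))" by simp
    then show ?thesis by (simp add: B_def algebra_simps)
  qed
  have AS: "s * (s ^ l + a * B ^ Suc (Suc j) + (real b - 1) * \<xi> * B ^ j) = s ^ Suc l + a * B ^ Suc j" for l j
  proof -
    have "s * (s ^ l + a * B ^ Suc (Suc j) + (real b - 1) * \<xi> * B ^ j)
        = s ^ Suc l + (s * B * a + \<beta>) * B ^ Suc j"
      using coeff[of j] by (simp add: algebra_simps)
    then show ?thesis unfolding a(2) .
  qed
  have AM: "s * (s ^ l + a * B ^ Suc (Suc j) + (real b - 1) * \<xi> * B ^ j +
      ((1 + \<kappa>) * B ^ j - \<kappa> * s ^ j - \<xi> * B ^ j))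
      = s ^ Suc l + a * B ^ Suc j + \<kappa> * (B ^ Suc j - s ^ Suc j)" for l j
  proof -
    have "(1 + \<kappa>) - \<xi> = \<kappa> * (real b * \<xi>)" using kap_eq by (simp add: algebra_simps)
    then have "s * B ^ j * ((1 + \<kappa>) - \<xi>) = s * B ^ j * (\<kappa> * (real b * \<xi>))" by simp
    then have "s * ((1 + \<kappa>) * B ^ j - \<kappa> * s ^ j - \<xi> * B ^ j) = \<kappa> * (B ^ Suc j - s ^ Suc j)"
      by (simp add: B_def algebra_simps)
    then show ?thesis using AS[of l j] by (simp add: distrib_left)
  qed
  have MS: "s * (((s / \<xi>) ^ l + c * B ^ Suc (Suc j)) / \<xi>) = (s / \<xi>) ^ Suc l + real b * s\<^sup>2 * c * B ^ Suc j" for l j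
  proof -
    have "s * (((s / \<xi>) ^ l + c * B ^ Suc (Suc j)) / \<xi>) = (s / \<xi>) ^ Suc l + (s / \<xi> * B) * c * B ^ Suc j"
      by (simp add: algebra_simps add_divide_distrib)
    then show ?thesis unfolding sxiB .
  qed
  show ?thesis
  proof
    show "0 \<le> s" "0 < \<xi>" "\<xi> \<le> 1" "1 \<le> b" "0 \<le> \<alpha>" using s xi b alpha by auto
    fix m
    show "0 \<le> B ^ (Suc h - m)" using B0 by simp
    show "\<xi> * B ^ (Suc h - m) \<le> (1 + \<kappa>) * B ^ (Suc h - m) - \<kappa> * s ^ (Suc h - m)"
      using mult_left_mono[OF pow_le[of "Suc h - m"] kap] mult_right_mono[OF xi(2), of "B ^ (Suc h - m)"] B0
      by (simp add: algebra_simps)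
    show "\<xi> * B ^ (Suc h - m) \<le> 1"
      using mult_mono[OF xi(2) B1[of "Suc h - m"]] B0 by simp
  next
    show "1 \<le> (1 + \<kappa>) * B ^ (Suc h - Suc h) - \<kappa> * s ^ (Suc h - Suc h)" "1 \<le> B ^ (Suc h - Suc h)" by auto
    show "1 \<le> s ^ 0 + a * B ^ (Suc h - 0)" "1 \<le> (s / \<xi>) ^ 0 + c * B ^ (Suc h - 0)"
      using a c B0 by auto
  next
    fix m assume "m \<in> {1..h}"
    then obtain j where j: "Suc h - Suc m = j" "Suc h - m = Suc j" by (auto simp: Suc_diff_le)
    show "s * ((1 + \<kappa>) * B ^ (Suc h - Suc m) - \<kappa> * s ^ (Suc h - Suc m) + (real b - 1) * \<xi> * B ^ (Suc h - Suc m))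
        \<le> (1 + \<kappa>) * B ^ (Suc h - m) - \<kappa> * s ^ (Suc h - m)"
      unfolding j onS ..
    show "s * (real b * \<xi> * B ^ (Suc h - Suc m)) \<le> B ^ (Suc h - m)"
      unfolding j by (simp add: B_def)
  next
    fix l assume l: "l \<in> {1..<h}"
    then obtain l' j where j: "l = Suc l'" "Suc h - Suc l = j" "Suc h - l = Suc j" "l - 1 = l'"
      "Suc h - l' = Suc (Suc j)"
      by (cases l) (auto simp: Suc_diff_le)
    show "s * (s ^ (l - 1) + a * B ^ (Suc h - (l - 1)) + (real b - 1) * \<xi> * B ^ (Suc h - Suc l))
        \<le> s ^ l + a * B ^ (Suc h - l)"
      unfolding j(2-5) AS unfolding j(1) ..
    show "s * (s ^ (l - 1) + a * B ^ (Suc h - (l - 1)) + (real b - 1) * \<xi> * B ^ (Suc h - Suc l) +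
        ((1 + \<kappa>) * B ^ (Suc h - Suc l) - \<kappa> * s ^ (Suc h - Suc l) - \<xi> * B ^ (Suc h - Suc l)))
        \<le> (s / \<xi>) ^ l + c * B ^ (Suc h - l)"
      using M[OF l] unfolding j(2-5) AM unfolding j(1) .
    have "s * (((s / \<xi>) ^ l' + c * B ^ Suc (Suc j)) / \<xi> + (real b - 1) * \<xi> * B ^ j)
        = (s / \<xi>) ^ Suc l' + (real b * s\<^sup>2 * c + \<beta>) * B ^ Suc j"
      unfolding distrib_left[of s] MS coeff by (simp add: algebra_simps)
    then show "s * (((s / \<xi>) ^ (l - 1) + c * B ^ (Suc h - (l - 1))) / \<xi> + (real b - 1) * \<xi> * B ^ (Suc h - Suc l))
        \<le> (s / \<xi>) ^ l + c * B ^ (Suc h - l)"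
      unfolding c(2) j(2-5) unfolding j(1) by (rule eq_refl)
  next
    fix l assume l: "l \<in> {1..h}"
    then obtain l' j where j: "l = Suc l'" "Suc h - Suc l = j" "Suc h - l = Suc j" "l - 1 = l'"
      "Suc h - l' = Suc (Suc j)"
      by (cases l) (auto simp: Suc_diff_le)
    have "s * (s ^ l' + a * B ^ Suc (Suc j) + ((1 + \<kappa>) * B ^ j - \<kappa> * s ^ j + (real b - 1) * \<xi> * B ^ j))
        = s ^ l + (s * a * B + 1 + \<kappa>) * B ^ Suc j - \<kappa> * s ^ Suc j"
      unfolding distrib_left[of s "s ^ l' + a * B ^ Suc (Suc j)"] onS j(1) by (simp add: algebra_simps)
    then show "s * (s ^ (l - 1) + a * B ^ (Suc h - (l - 1)) + ((1 + \<kappa>) * B ^ (Suc h - Suc l) -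
        \<kappa> * s ^ (Suc h - Suc l) + (real b - 1) * \<xi> * B ^ (Suc h - Suc l))) \<le> \<alpha>"
      using on[OF l] unfolding j(2-5) by simp
    have "s * (((s / \<xi>) ^ l' + c * B ^ Suc (Suc j)) / \<xi> + real b * \<xi> * B ^ j)
        = (s / \<xi>) ^ l + (real b * s\<^sup>2 * c + 1) * B ^ Suc j"
      unfolding distrib_left[of s] MS j(1) by (simp add: B_def algebra_simps)
    then show "s * (((s / \<xi>) ^ (l - 1) + c * B ^ (Suc h - (l - 1))) / \<xi> + real b * \<xi> * B ^ (Suc h - Suc l)) \<le> \<alpha>"
      using off[OF l] unfolding j(2-5) by simp
  qed
qed

text \<open>One contraction factor serves all eight degrees; its value is dictated by \<Delta> =
  9.\<close>

abbreviation (input) certified :: "nat \<Rightarrow> nat \<Rightarrow> real \<Rightarrow> bool" where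
  "certified b h s \<equiv> \<exists>\<xi> on off A M. influence_certificate b h s \<xi> (9997 / 10000) on off A M"

text \<open>For fixed h only finitely many inequalities between rationals remain; as lists they can
  be evaluated level by level.\<close>

lemma certified_by_enumeration:
  fixes b h :: nat and s \<xi> B \<kappa> \<beta> a c :: real
  assumes "B = s * real b * \<xi>" "\<kappa> = (1 - \<xi>) / (real b * \<xi> - 1)" "\<beta> = (real b - 1) / real b"
    and "a = \<beta> / (1 - s * B)" "c = \<beta> / (1 - real b * s\<^sup>2)"
    and "0 < s" "0 < \<xi>" "\<xi> \<le> 1" "1 \<le> b" "1 < real b * \<xi>" "B \<le> 1" "s * B < 1" "real b * s\<^sup>2 < 1"
    and M: "list_all (\<lambda>l. s ^ l + a * B ^ (Suc h - l) + \<kappa> * (B ^ (Suc h - l) - s ^ (Suc h - l))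
        \<le> (s / \<xi>) ^ l + c * B ^ (Suc h - l)) [1..<h]"
    and on: "list_all (\<lambda>l. s ^ l + (s * a * B + 1 + \<kappa>) * B ^ (Suc h - l) - \<kappa> * s ^ (Suc h - l)
        \<le> 9997 / 10000) [1..<Suc h]"
    and off: "list_all (\<lambda>l. (s / \<xi>) ^ l + (real b * s\<^sup>2 * c + 1) * B ^ (Suc h - l) \<le> 9997 / 10000) [1..<Suc h]"
  shows "certified b h s"
proof (intro exI, rule closed_form_certificate[OF assms(1-13)])
  show "0 \<le> (9997 / 10000 :: real)" by simp
qed (use M on off in \<open>auto simp: list_all_iff\<close>)

text \<open>Only \<xi> is a choice, the other values follow from it. Here and below it lies between
  s, so that s / \<xi> < 1, and 1 / (s * b * (b * s^2 * c + 1)), so that the second term of the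
  off-path total stays below 1 at the bottom level.\<close>

lemma certified_3: "certified 2 15 (1/2)"
  by (rule certified_by_enumeration[where \<xi> = "4/7" and B = "4/7" and \<kappa> = 3 and \<beta> = "1/2" and a = "7/10" and c = 1])
    (simp_all add: upt_conv_Cons power_divide)

lemma certified_4: "certified 3 3 (1/3)"
  by (rule certified_by_enumeration[where \<xi> = "1/2" and B = "1/2" and \<kappa> = 1 and \<beta> = "2/3" and a = "4/5" and c = 1])
    (simp_all add: upt_conv_Cons power_divide)

lemma certified_5: "certified 4 12 (1/3)"
  by (rule certified_by_enumeration[where \<xi> = "2/5" and B = "8/15" and \<kappa> = 1 and \<beta> = "3/4"
      and a = "135/148" and c = "27/20"])
    (simp_all add: upt_conv_Cons power_divide)

lemma certified_6: "certified 5 3 (1/4)"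
  by (rule certified_by_enumeration[where \<xi> = "2/5" and B = "1/2" and \<kappa> = "3/5" and \<beta> = "4/5"
      and a = "32/35" and c = "64/55"])
    (simp_all add: upt_conv_Cons power_divide)

lemma certified_7: "certified 6 7 (1/4)"
  by (rule certified_by_enumeration[where \<xi> = "1/3" and B = "1/2" and \<kappa> = "2/3" and \<beta> = "5/6"
      and a = "20/21" and c = "4/3"])
    (simp_all add: upt_conv_Cons power_divide)

lemma certified_8: "certified 7 13 (1/4)"
  by (rule certified_by_enumeration[where \<xi> = "3/10" and B = "21/40" and \<kappa> = "7/11" and \<beta> = "6/7"
      and a = "960/973" and c = "32/21"])
    (simp_all add: upt_conv_Cons power_divide)

lemma certified_10: "certified 9 5 (1/5)"
  by (rule certified_by_enumeration[where \<xi> = "2/7" and B = "18/35" and \<kappa> = "5/11" and \<beta> = "8/9"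
      and a = "1400/1413" and c = "25/18"])
    (simp_all add: upt_conv_Cons power_divide)

text \<open>Here the margin is tightest at the bottom level \<open>l = 85\<close>, where the left-hand side of the last
  condition is about \<open>0.9996\<close>; this is why the height has to be so large.\<close>

lemma certified_9: "certified 8 85 (1/4)"
\<comment> \<open>For s = 1/4 and b = 8 the admissible range is only 1/4 < \<xi> < 4/15. The choice
  5/19 gives s / \<xi> = 19/20, whose powers decay slowly.\<close>
proof (intro exI, rule closed_form_certificate[where \<xi> = "5/19" and B = "10/19" and \<kappa> = "2/3"
      and \<beta> = "7/8" and a = "133/132" and c = "7/4"])
  fix l :: nat
  assume l: "l \<in> {1..<85}"
  have "133/132 * (10/19) ^ (Suc 85 - l) + 2/3 * (10/19) ^ (Suc 85 - l) \<le> 7/4 * (10/19::real) ^ (Suc 85 - l)"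
    unfolding distrib_right[symmetric] by (rule mult_right_mono) auto
  moreover have "(1/4) ^ l \<le> (1/4 / (5/19) :: real) ^ l" by (rule power_mono) auto
  ultimately show "(1/4) ^ l + 133/132 * (10/19) ^ (Suc 85 - l) + 2/3 * ((10/19) ^ (Suc 85 - l) - (1/4) ^ (Suc 85 - l))
      \<le> (1/4 / (5/19)) ^ l + 7/4 * (10/19::real) ^ (Suc 85 - l)"
    unfolding right_diff_distrib using zero_le_power[of "1/4::real" "Suc 85 - l"] by linarith
next
  fix l :: nat
  assume "l \<in> {1..85}"
  then consider "l = 85" | "1 \<le> l" "2 \<le> Suc 85 - l" by force
  then show "(1/4) ^ l + (1/4 * (133/132) * (10/19) + 1 + 2/3) * (10/19) ^ (Suc 85 - l) - 2/3 * (1/4) ^ (Suc 85 - l)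
      \<le> (9997/10000 :: real)"
  proof cases
    case 1
    have "(1/4) ^ 85 \<le> (1/4 :: real) ^ 2" by (rule power_decreasing) auto
    then show ?thesis unfolding 1 by (simp add: power2_eq_square)
  next
    case 2
    have "(1/4) ^ l \<le> (1/4 :: real)" using power_decreasing[of 1 l "1/4::real"] 2 by simp
    moreover have "(10/19) ^ (Suc 85 - l) \<le> (100/361 :: real)"
      using power_decreasing[of 2 "Suc 85 - l" "10/19::real"] 2 by (simp add: power2_eq_square)
    moreover have "0 \<le> (1/4 :: real) ^ (Suc 85 - l)" by simp
    moreover have "1/4 * (133/132) * (10/19) + 1 + 2/3 = (475/264 :: real)" by simp
    ultimately show ?thesis by (simp only:)
  qed
next
  fix l :: nat
  assume "l \<in> {1..85}"
  \<comment> \<open>The first summand decreases in l and the second increases, so on each range both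
    are bounded at opposite ends. Only l = 85 has to be evaluated exactly.\<close>
  then consider "l = 85" | "81 \<le> l" "2 \<le> Suc 85 - l" | "1 \<le> l" "6 \<le> Suc 85 - l" by force
  then show "(1/4 / (5/19)) ^ l + (real 8 * (1/4)\<^sup>2 * (7/4) + 1) * (10/19) ^ (Suc 85 - l) \<le> (9997/10000 :: real)"
  proof cases
    case 1
    show ?thesis unfolding 1 by (simp add: power_divide)
  next
    case 2
    have "(19/20) ^ l \<le> (19/20 :: real) ^ 81" "(10/19) ^ (Suc 85 - l) \<le> (10/19 :: real) ^ 2"
      by (rule power_decreasing; use 2 in simp)+
    then have "(19/20) ^ l + 15/8 * (10/19) ^ (Suc 85 - l) \<le> (19/20) ^ 81 + 15/8 * (10/19 :: real) ^ 2"
      by linarith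
    also have "\<dots> \<le> 9997/10000" by (simp add: power_divide)
    finally show ?thesis by (simp add: power2_eq_square)
  next
    case 3
    have "(19/20) ^ l \<le> (19/20 :: real) ^ 1" "(10/19) ^ (Suc 85 - l) \<le> (10/19 :: real) ^ 6"
      by (rule power_decreasing; use 3 in simp)+
    then have "(19/20) ^ l + 15/8 * (10/19) ^ (Suc 85 - l) \<le> (19/20) ^ 1 + 15/8 * (10/19 :: real) ^ 6"
      by linarith
    also have "\<dots> \<le> 9997/10000" by (simp add: power_divide)
    finally show ?thesis by (simp add: power2_eq_square)
  qed
qed (simp_all add: power2_eq_square)

lemma tree_certified:
  assumes "\<Delta> \<in> {3..10}"
  shows "certified (\<Delta> - 1) (tree_h \<Delta>) (1 / (real (tree_f \<Delta>) - real \<Delta>))"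
proof -
  consider "\<Delta> = 3" | "\<Delta> = 4" | "\<Delta> = 5" | "\<Delta> = 6" | "\<Delta> = 7" | "\<Delta> = 8" | "\<Delta> = 9" | "\<Delta> = 10"
    using assms by force
  then show ?thesis
    using certified_3 certified_4 certified_5 certified_6 certified_7 certified_8 certified_9 certified_10
    by cases (simp_all add: tree_h_def tree_f_def)
qed

lemma tree_h_f_bounds:
  assumes "\<Delta> \<in> {3..10}"
  shows "1 \<le> tree_h \<Delta>" "\<Delta> < tree_f \<Delta>"
proof -
  consider "\<Delta> = 3" | "\<Delta> = 4" | "\<Delta> = 5" | "\<Delta> = 6" | "\<Delta> = 7" | "\<Delta> = 8" | "\<Delta> = 9" | "\<Delta> = 10"
    using assms by force
  then show "1 \<le> tree_h \<Delta>" "\<Delta> < tree_f \<Delta>"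
    by (cases; simp add: tree_h_def tree_f_def)+
qed

theorem theorem4:
  fixes \<Delta> q :: nat
  assumes "\<Delta> \<in> {3..10}" and "tree_f \<Delta> \<le> q"
  shows "\<exists>K::real. \<forall>(n::nat) (G::nat pair_pre_digraph) \<rho> \<Theta>s (\<epsilon>::real).
    undirected_tree G \<and> pverts G = {1..n} \<and> \<rho> \<in> pverts G \<and> max_degree G = \<Delta> \<and>
    subtree_block_cover G \<rho> (tree_h \<Delta>) \<Theta>s \<and> 0 < \<epsilon> \<and> \<epsilon> \<le> 1 \<longrightarrow>
    ereal_of_enat (mixing_time (proper_colourings G q) (systematic_scan G q \<Theta>s)
        (pmf_of_set (proper_colourings G q)) \<epsilon>)
      \<le> ereal (K * ln (real n / \<epsilon>))"
proof -
  define \<alpha> :: real where "\<alpha> = 9997 / 10000"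
  define s where "s = 1 / (real (tree_f \<Delta>) - real \<Delta>)"
  obtain \<xi> on off A M where cert: "influence_certificate (\<Delta> - 1) (tree_h \<Delta>) s \<xi> \<alpha> on off A M"
    using tree_certified[OF assms(1)] unfolding \<alpha>_def s_def by blast
  have q: "\<Delta> < q" using tree_h_f_bounds(2)[OF assms(1)] assms(2) by simp
  have s_ge: "1 / (real q - real \<Delta>) \<le> s"
    unfolding s_def using assms(2) tree_h_f_bounds(2)[OF assms(1)] by (intro divide_left_mono) auto
  show ?thesis
  \<comment> \<open>The constant comes from \<open>scans_needed\<close>; as \<alpha> is the same in
    all cases, it does not even vary with \<Delta> and q.\<close>
  proof (rule exI[of _ "1 + 2 / - ln \<alpha>"], intro allI impI, elim conjE)
    fix n :: nat and G :: "nat pair_pre_digraph" and \<rho> \<Theta>s and \<epsilon> :: real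
    assume tree: "undirected_tree G" and V: "pverts G = {1..n}" and root: "\<rho> \<in> pverts G"
      and deg_eq: "max_degree G = \<Delta>" and cover: "subtree_block_cover G \<rho> (tree_h \<Delta>) \<Theta>s"
      and eps: "0 < \<epsilon>" "\<epsilon> \<le> 1"
    interpret T: rooted_undirected_tree G \<rho> by unfold_locales (rule tree root)+
    interpret influence_certificate "\<Delta> - 1" "tree_h \<Delta>" s \<xi> \<alpha> on off A M by (rule cert)
    interpret certified_colouring G \<rho> "\<Delta> - 1" "tree_h \<Delta>" s \<xi> \<alpha> on off A M q \<Delta>
    proof unfold_locales
      show "card (T.children v) \<le> \<Delta> - 1" if "v \<in> pverts G" "v \<noteq> \<rho>" for v
        using T.card_children_le[OF that(1)] that(2) deg_eq by simp
      show "card (T.children \<rho>) \<le> Suc (\<Delta> - 1)"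
        using T.card_children_le[OF root] deg_eq assms(1) by simp
    qed (use deg_eq q s_ge tree_h_f_bounds(1)[OF assms(1)] in \<open>auto simp: \<alpha>_def\<close>)
    \<comment> \<open>Some site has \<Delta> \<ge> 3 neighbours, so n \<ge> 3, as
      \<open>scans_needed\<close> demands.\<close>
    have "max_degree G \<in> out_degree G ` pverts G"
      unfolding max_degree_def using root T.finite_V by (intro Max_in) auto
    then obtain v where v: "max_degree G = out_degree G v" by blast
    have "\<Delta> \<le> card (pverts G)" unfolding deg_eq[symmetric] v out_degree_def
      by (rule card_inj_on_le[of snd]) (use T.in_arcsD2 T.finite_V in \<open>auto simp: inj_on_def\<close>)
    then have n: "3 \<le> real n" using assms(1) V by simp
    obtain t where t: "0 < t" "\<alpha> ^ t * (real n)\<^sup>2 \<le> \<epsilon>" "real t \<le> (1 + 2 / - ln \<alpha>) * ln (real n / \<epsilon>)"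
      using scans_needed[of \<alpha> "real n" \<epsilon>] n eps by (auto simp: \<alpha>_def)
    have "mixing_time (proper_colourings G q) (systematic_scan G q \<Theta>s) (pmf_of_set (proper_colourings G q)) \<epsilon> \<le> enat t"
    proof (rule mixing_time_le[OF _ proper_colourings_nonempty t(1)])
      show "finite (proper_colourings G q)"
        unfolding proper_colourings_eq_updates[OF T.E_subset, where x = undefined] by (rule finite_updates[OF T.finite_V])
      fix x assume "x \<in> proper_colourings G q"
      from scan_tv_dist_le[OF cover this, of t] t(2)
      show "tv_dist (proper_colourings G q) (kernel_power (systematic_scan G q \<Theta>s) t x)
          (pmf_of_set (proper_colourings G q)) \<le> \<epsilon>"
        by (simp add: V)
    qed
    then have "ereal_of_enat (mixing_time (proper_colourings G q) (systematic_scan G q \<Theta>s)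
        (pmf_of_set (proper_colourings G q)) \<epsilon>) \<le> ereal_of_enat (enat t)"
      by (simp only: ereal_of_enat_le_iff)
    also have "\<dots> = ereal (real t)" by simp
    also have "\<dots> \<le> ereal ((1 + 2 / - ln \<alpha>) * ln (real n / \<epsilon>))" using t(3) by (simp only: ereal_less_eq)
    finally show "ereal_of_enat (mixing_time (proper_colourings G q) (systematic_scan G q \<Theta>s)
        (pmf_of_set (proper_colourings G q)) \<epsilon>) \<le> ereal ((1 + 2 / - ln \<alpha>) * ln (real n / \<epsilon>))" .
  qed
qed

end
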